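(* Let $0<a\le 1/2$. Then the following are equivalent: (i) the real zeros of $P(s,a)$ are exactly the negative even integers $-2,-4,-6,\dots$, and each of them is a simple zero; (ii) $1/4\le a\le 1/2$.
   Context: For $0<a<1$ the periodic zeta function $\mathrm{Li}_s(e^{2\pi i a})=\sum_{n=1}^\infty e^{2\pi i n a}n^{-s}$ ($\Re(s)>1$) extends to an entire function of $s\in\mathbb{C}$. For $0<a\le 1/2$ define the entire function $P(s,a)=\mathrm{Li}_s(e^{2\pi i a})+\mathrm{Li}_s(e^{2\pi i(1-a)})$. *)

theory Defs
  imports "HOL-Complex_Analysis.Complex_Analysis"
begin

definition periodic_zeta_series :: "real \<Rightarrow> complex \<Rightarrow> complex" where
  "periodic_zeta_series a s =
     (\<Sum>n. exp (2 * of_real pi * \<i> * of_nat (Suc n) * of_real a) * of_nat (Suc n) powr (- s))"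

text \<open>
  For \<open>0 < a < 1\<close>, \<open>periodic_zeta a s\<close> is \<open>Li_s (exp (2 \<pi> i a))\<close>: the entire function
  of \<open>s\<close> extending the Dirichlet series from \<open>Re s > 1\<close>. By the identity theorem there is at most
  one such function (lemma \<open>periodic_zeta_eqI\<close>). Other values of \<open>a\<close> are irrelevant; for integer
  \<open>a\<close> no such function exists and the description is unspecified.
\<close>
definition periodic_zeta :: "real \<Rightarrow> complex \<Rightarrow> complex" where
  "periodic_zeta a =
     (THE f. f holomorphic_on UNIV \<and> (\<forall>s. Re s > 1 \<longrightarrow> f s = periodic_zeta_series a s))"

lemma periodic_zeta_eqI:
  assumes "f holomorphic_on UNIV" "\<And>s. Re s > 1 \<Longrightarrow> f s = periodic_zeta_series a s"
  shows "periodic_zeta a = f"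
  unfolding periodic_zeta_def
proof (rule the_equality)
  show "f holomorphic_on UNIV \<and> (\<forall>s. Re s > 1 \<longrightarrow> f s = periodic_zeta_series a s)"
    using assms by blast
next
  fix g
  assume g: "g holomorphic_on UNIV \<and> (\<forall>s. Re s > 1 \<longrightarrow> g s = periodic_zeta_series a s)"
  show "g = f"
  proof
    fix w
    show "g w = f w"
    proof (rule analytic_continuation_open[of "{s. Re s > 1}" UNIV g f])
      show "{s. Re s > 1} \<noteq> {}" by (auto intro!: exI[of _ 2])
    qed (use g assms in \<open>auto simp: open_halfspace_Re_gt\<close>)
  qed
qed

definition P :: "complex \<Rightarrow> real \<Rightarrow> complex" where
  "P s a = periodic_zeta a s + periodic_zeta (1 - a) s"

end

theory Submission
  imports Defs "HOL-Real_Asymp.Real_Asymp"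
begin

text \<open>
  Let \<open>z = exp (2 \<pi> i a)\<close> and \<open>f x = z / (exp x - z)\<close>, so that \<open>\<Gamma>(s) Li\<^sub>s(z)\<close> is the Mellin
  transform of \<open>f\<close> for \<open>Re s > 0\<close>; integrating by parts repeatedly continues it to the whole plane.
  For real \<open>s > 0\<close>, \<open>P(s,a)\<close> is a positive multiple of the Mellin transform of \<open>2 Re f\<close>, which is
  negative when \<open>cos (2 \<pi> a) \<le> 0\<close>. If \<open>cos (2 \<pi> a) > 0\<close>, then \<open>P(0,a) = -1\<close> and
  \<open>P(s,a) \<rightarrow> 2 cos (2 \<pi> a)\<close> as \<open>s \<rightarrow> \<infinity>\<close> force a positive zero.

  For negative \<open>s\<close> the partial fractions of the cotangent give
  \<open>1 + 2 Re f(x) = \<Sum> 2x / (x\<^sup>2 + w\<^sup>2)\<close> with \<open>w\<close> running over \<open>2 \<pi> (n + a)\<close> and \<open>2 \<pi> (n + 1 - a)\<close>.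
  Taking Mellin transforms termwise for \<open>-1 < s < 0\<close> yields
  \<open>P(s,a) cos (\<pi> s / 2) = \<pi> / \<Gamma>(s) \<cdot> \<Sum> w\<^sup>s\<^sup>-\<^sup>1\<close>, which persists for all \<open>Re s < 0\<close>. The sum is positive
  for real \<open>s\<close>, so the zeros come from \<open>1 / \<Gamma>(s)\<close>; those at odd integers are absorbed by the cosine.
\<close>

subsection \<open>Mellin transforms\<close>

lemma continuous_on_powr_pos [continuous_intros]:
  "continuous_on {0<..} (\<lambda>x::real. complex_of_real x powr s)"
  by (intro continuous_intros) (auto simp: complex_nonpos_Reals_iff)

lemma set_borel_measurable_continuous:
  fixes f :: "real \<Rightarrow> 'a :: {banach, second_countable_topology}"
  assumes "continuous_on {0<..} f"
  shows "set_borel_measurable lborel {0<..} f"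
  using borel_measurable_continuous_on_indicator[OF _ assms] by (simp add: set_borel_measurable_def)

lemma norm_powr_pos:
  "x > 0 \<Longrightarrow> norm (complex_of_real x powr s) = x powr Re s"
  by (simp add: norm_powr_real_powr)

lemma set_integrable_powr_exp_complex:
  assumes "Re s > 0" "n > 0"
  shows "set_integrable lborel {0<..} (\<lambda>x::real. of_real x powr (s - 1) * complex_of_real (exp (- (n * x))))"
proof -
  have "set_borel_measurable lborel {0<..} (\<lambda>x::real. of_real x powr (s - 1) * complex_of_real (exp (- (n * x))))"
    by (intro set_borel_measurable_continuous continuous_intros)
  moreover have "set_integrable lebesgue {0<..} (\<lambda>x::real. of_real x powr (s - 1) * complex_of_real (exp (- (n * x))))"
    using absolutely_integrable_Gamma_integral[OF assms] by (simp add: exp_minus field_simps)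
  \<comment> \<open>Integrability over the completion \<open>lebesgue\<close> descends to
    \<open>lborel\<close> because the integrand is Borel measurable.\<close>
  ultimately show ?thesis
    unfolding set_integrable_def set_borel_measurable_def
    by (subst (asm) integrable_completion) auto
qed

lemma set_integrable_powr_exp:
  assumes "c > 0" "n > 0"
  shows "set_integrable lborel {0<..} (\<lambda>x::real. x powr (c - 1) * exp (- (n * x)))"
proof -
  have "set_integrable lborel {0<..} (\<lambda>x::real. norm (of_real x powr (of_real c - 1) * complex_of_real (exp (- (n * x)))))"
    using assms by (intro set_integrable_norm set_integrable_powr_exp_complex) auto
  then show ?thesis
    by (rule set_integrable_cong[THEN iffD1, rotated -1]) (auto simp: norm_mult norm_powr_pos)
qed

text \<open>Substitute \<open>n * x\<close> for \<open>x\<close> in Euler's integral;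
  \<open>n powr (s - 1)\<close> and the Jacobian \<open>n\<close> combine to
  \<open>n powr s\<close>.\<close>

lemma integral_powr_exp_complex:
  assumes "Re s > 0" "n > 0"
  shows "(LBINT x:{0<..}. of_real x powr (s - 1) * complex_of_real (exp (- (n * x)))) = Gamma s * of_real n powr (- s)"
proof -
  define f where "f = (\<lambda>x::real. indicator {0<..} x *\<^sub>R (of_real x powr (s - 1) * complex_of_real (exp (- x))))"
  have "integral\<^sup>L lborel f = integral {0<..} (\<lambda>x::real. of_real x powr (s - 1) * complex_of_real (exp (- x)))"
    using set_borel_integral_eq_integral(2)[OF set_integrable_powr_exp_complex[OF assms(1), of 1]]
    by (simp add: f_def set_lebesgue_integral_def)
  also have "\<dots> = Gamma s"
    using Gamma_integral_complex'[OF assms(1)] by (intro integral_unique) (simp add: exp_minus field_simps)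
  finally have "Gamma s = n *\<^sub>R (LBINT x. f (n * x))"
    using lborel_integral_real_affine[of n f 0] assms by simp
  also have "(LBINT x. f (n * x)) = (LBINT x. of_real n powr (s - 1) * (indicator {0<..} x *\<^sub>R (of_real x powr (s - 1) * complex_of_real (exp (- (n * x))))))"
    using assms by (intro Bochner_Integration.integral_cong)
      (auto simp: f_def indicator_def zero_less_mult_iff powr_times_real)
  also have "\<dots> = of_real n powr (s - 1) * (LBINT x:{0<..}. of_real x powr (s - 1) * complex_of_real (exp (- (n * x))))"
    by (simp add: set_lebesgue_integral_def flip: mult_scaleR_right)
  finally have "Gamma s = of_real n powr s * (LBINT x:{0<..}. of_real x powr (s - 1) * complex_of_real (exp (- (n * x))))"
    using assms by (simp add: scaleR_conv_of_real powr_diff)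
  then show ?thesis
    using assms by (simp add: powr_minus field_simps)
qed

lemma integral_powr_exp:
  assumes "c > 0" "n > 0"
  shows "(LBINT x:{0::real<..}. x powr (c - 1) * exp (- (n * x))) = Gamma c * n powr (- c)"
proof -
  have "complex_of_real (LBINT x:{0::real<..}. x powr (c - 1) * exp (- (n * x)))
     = (LBINT x:{0<..}. complex_of_real (x powr (c - 1) * exp (- (n * x))))"
    by (rule set_integral_complex_of_real[symmetric])
  also have "\<dots> = (LBINT x:{0<..}. of_real x powr (of_real c - 1) * complex_of_real (exp (- (n * x))))"
    by (intro set_lebesgue_integral_cong) (auto simp: powr_of_real[symmetric])
  also have "\<dots> = Gamma (of_real c) * of_real n powr (- of_real c)"
    using assms by (intro integral_powr_exp_complex) auto
  also have "\<dots> = of_real (Gamma c * n powr (- c))"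
    using assms by (simp add: Gamma_complex_of_real powr_of_real flip: of_real_minus)
  finally show ?thesis by (simp only: of_real_eq_iff)
qed

definition mellin :: "(real \<Rightarrow> complex) \<Rightarrow> complex \<Rightarrow> complex" where
  "mellin h s = (LBINT x:{0<..}. of_real x powr (s - 1) * h x)"

lemma mellin_integrable:
  assumes "continuous_on {0<..} h" "\<And>x. x > 0 \<Longrightarrow> norm (h x) \<le> C * exp (- x)" "Re s > 0"
  shows "set_integrable lborel {0<..} (\<lambda>x. of_real x powr (s - 1) * h x)"
proof (rule set_integrable_bound)
  show "set_integrable lborel {0<..} (\<lambda>x::real. C * (x powr (Re s - 1) * exp (- (1 * x))))"
    using assms by (intro set_integrable_mult_right set_integrable_powr_exp) auto
  show "set_borel_measurable lborel {0<..} (\<lambda>x. of_real x powr (s - 1) * h x)"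
    using assms by (intro set_borel_measurable_continuous continuous_intros)
  have "norm (of_real x powr (s - 1) * h x) \<le> C * (x powr (Re s - 1) * exp (- (1 * x)))" if "x > 0" for x
    using mult_left_mono[OF assms(2)[OF that], of "x powr (Re s - 1)"] that
    by (simp add: norm_mult norm_powr_pos mult_ac)
  then show "AE x in lborel. x \<in> {0<..} \<longrightarrow> norm (of_real x powr (s - 1) * h x)
      \<le> norm (C * (x powr (Re s - 1) * exp (- (1 * x))))"
    by (intro AE_I2 impI) (metis abs_ge_self greaterThan_iff order_trans real_norm_def)
qed

text \<open>Truncations to compact intervals are holomorphic by differentiation under the integral
  sign, and they converge locally uniformly because one integrable majorant serves a whole ball of
  values of \<open>s\<close>.\<close>

lemma mellin_holomorphic:
  assumes "continuous_on {0<..} h" "\<And>x. x > 0 \<Longrightarrow> norm (h x) \<le> K * exp (- x)"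
  shows "mellin h holomorphic_on {s. Re s > 0}"
proof (rule holomorphic_uniform_sequence)
  define I where "I = (\<lambda>n::nat. {1 / (real n + 1)..real n + 1})"
  have I_sub: "I n \<subseteq> {0<..}" for n
  proof
    fix x assume "x \<in> I n"
    moreover have "0 < 1 / (real n + 1)" by simp
    ultimately show "x \<in> {0<..}" unfolding I_def atLeastAtMost_iff greaterThan_iff by linarith
  qed
  define F where "F = (\<lambda>n s. integral (I n) (\<lambda>x. of_real x powr (s - 1) * h x))"
  have contI: "continuous_on (I n) (\<lambda>x. of_real x powr (s - 1) * h x)" for n s
    by (rule continuous_on_subset[OF _ I_sub]) (intro continuous_intros assms)
  show "open {s. 0 < Re s}" by (rule open_halfspace_Re_gt)
  show "F n holomorphic_on {s. 0 < Re s}" for n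
  proof -
    have "(\<lambda>s. integral (cbox (1 / (real n + 1)) (real n + 1)) ((\<lambda>s x. of_real x powr (s - 1) * h x) s)) holomorphic_on {s. 0 < Re s}"
    proof (rule leibniz_rule_holomorphic[where fx = "\<lambda>s x. Ln (of_real x) * of_real x powr (s - 1) * h x"])
      fix s t assume "t \<in> cbox (1 / (real n + 1)) (real n + 1)"
      then have "t > 0" using I_sub[of n] by (auto simp: I_def)
      then show "((\<lambda>s. of_real t powr (s - 1) * h t) has_field_derivative Ln (of_real t) * of_real t powr (s - 1) * h t) (at s within {s. 0 < Re s})"
        by (auto simp: powr_def intro!: derivative_eq_intros)
    next
      show "(\<lambda>x. of_real x powr (s - 1) * h x) integrable_on cbox (1 / (real n + 1)) (real n + 1)" for s
        using integrable_continuous_real[OF contI[of n, unfolded I_def]] by simp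
    next
      have "cbox (1 / (real n + 1)) (real n + 1) \<subseteq> {0<..}" using I_sub[of n] by (simp add: I_def)
      then show "continuous_on ({s. 0 < Re s} \<times> cbox (1 / (real n + 1)) (real n + 1)) (\<lambda>(s, t). Ln (of_real t) * of_real t powr (s - 1) * h t)"
        unfolding case_prod_unfold
        by (intro continuous_intros continuous_on_compose2[OF assms(1)])
           (auto simp: complex_nonpos_Reals_iff)
    next
      show "convex {s. 0 < Re s}" by (rule convex_halfspace_Re_gt)
    qed
    then show ?thesis by (simp add: F_def I_def)
  qed
  fix s0 :: complex assume s0: "s0 \<in> {s. 0 < Re s}"
  \<comment> \<open>With this radius, real parts in the ball stay between \<open>Re s0 / 2\<close>
    and \<open>3 / 2 * Re s0\<close>, away from 0.\<close>
  define d where "d = Re s0 / 2"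
  \<comment> \<open>The first power controls \<open>x \<le> 1\<close>, the second
    \<open>x > 1\<close>; their sum is a majorant on the whole half-line.\<close>
  define b where "b = (\<lambda>x. K * (x powr (Re s0 / 2 - 1) * exp (- x) + x powr (3 / 2 * Re s0 - 1) * exp (- x)))"
  have K: "K \<ge> 0"
  proof -
    have "0 \<le> K * exp (- 1)" using order_trans[OF norm_ge_zero assms(2)[of 1]] by simp
    then show ?thesis by (simp add: zero_le_mult_iff)
  qed
  have d: "d > 0" using s0 by (simp add: d_def)
  have Re_bd: "Re s \<ge> Re s0 / 2" "Re s \<le> 3 / 2 * Re s0" if "s \<in> cball s0 d" for s
    using that abs_Re_le_cmod[of "s - s0"] by (auto simp: dist_norm d_def norm_minus_commute)
  have b_int: "set_integrable lborel {0<..} b"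
    unfolding b_def using set_integrable_powr_exp[of "Re s0 / 2" 1] set_integrable_powr_exp[of "3 / 2 * Re s0" 1] s0
    by (intro set_integrable_mult_right set_integral_add) auto
  have b_bd: "norm (of_real x powr (s - 1) * h x) \<le> b x" if "x > 0" "s \<in> cball s0 d" for x s
  proof -
    have "x powr (Re s - 1) \<le> x powr (Re s0 / 2 - 1) + x powr (3 / 2 * Re s0 - 1)"
    proof (cases "x \<le> 1")
      case True
      then have "x powr (Re s - 1) \<le> x powr (Re s0 / 2 - 1)"
        using that Re_bd[of s] by (intro powr_mono') auto
      then show ?thesis by (simp add: add_increasing2)
    next
      case False
      then have "x powr (Re s - 1) \<le> x powr (3 / 2 * Re s0 - 1)"
        using that Re_bd[of s] by (intro powr_mono) auto
      then show ?thesis by (simp add: add_increasing)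
    qed
    then have "x powr (Re s - 1) * norm (h x) \<le> (x powr (Re s0 / 2 - 1) + x powr (3 / 2 * Re s0 - 1)) * (K * exp (- x))"
      using that by (intro mult_mono assms) auto
    then show ?thesis using that by (simp add: norm_mult norm_powr_pos b_def algebra_simps)
  qed
  \<comment> \<open>\<open>E n\<close> is the mass of the majorant outside \<open>I n\<close>. It
    does not depend on \<open>s\<close>, so its convergence to 0 gives uniform convergence on the
    ball.\<close>
  define E where "E = (\<lambda>n. LBINT x:{0<..}. indicator (- I n) x *\<^sub>R b x)"
  have E_int: "set_integrable lborel {0<..} (\<lambda>x. indicator (- I n) x *\<^sub>R b x)" for n
  proof -
    have "integrable lborel (\<lambda>x. indicator (- I n) x *\<^sub>R (indicator {0<..} x *\<^sub>R b x))"
      using b_int unfolding set_integrable_def I_def by (rule integrable_mult_indicator[rotated]) simp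
    then show ?thesis by (simp add: set_integrable_def mult_ac)
  qed
  have "E \<longlonglongrightarrow> (LBINT x::real. 0)"
    unfolding E_def set_lebesgue_integral_def
  proof (rule integral_dominated_convergence)
    show "integrable lborel (\<lambda>x. indicator {0<..} x *\<^sub>R b x)" using b_int by (simp add: set_integrable_def)
    show "(\<lambda>x. indicator {0<..} x *\<^sub>R indicator (- I n) x *\<^sub>R b x) \<in> borel_measurable lborel" for n
      using E_int[of n] by (auto simp: set_integrable_def)
    have "(\<lambda>n. indicator {0<..} x *\<^sub>R indicator (- I n) x *\<^sub>R b x) \<longlonglongrightarrow> 0" for x
    proof (cases "x > 0")
      case True
      have "eventually (\<lambda>n. real n \<ge> max x (1 / x)) sequentially"
        by (rule eventually_compose_filterlim[OF eventually_ge_at_top filterlim_real_sequentially])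
      then have "eventually (\<lambda>n. x \<in> I n) sequentially"
      proof eventually_elim
        case (elim n)
        then have "1 / x \<le> real n + 1" by simp
        then have "1 / (real n + 1) \<le> x" using True by (simp add: field_simps)
        then show ?case using elim by (simp add: I_def)
      qed
      then have "eventually (\<lambda>n. indicator {0<..} x *\<^sub>R indicator (- I n) x *\<^sub>R b x = 0) sequentially"
        by eventually_elim auto
      then show ?thesis by (rule tendsto_eventually)
    qed auto
    then show "AE x in lborel. (\<lambda>n. indicator {0<..} x *\<^sub>R indicator (- I n) x *\<^sub>R b x) \<longlonglongrightarrow> 0" by simp
    have "b x \<ge> 0" for x using K by (simp add: b_def)
    then show "AE x in lborel. norm (indicator {0<..} x *\<^sub>R indicator (- I n) x *\<^sub>R b x) \<le> indicator {0<..} x *\<^sub>R b x" for n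
      by (intro AE_I2) (auto simp: indicator_def)
  qed simp
  then have E_lim: "E \<longlonglongrightarrow> 0" by simp
  have diff: "dist (F n s) (mellin h s) \<le> E n" if "s \<in> cball s0 d" for n s
  proof -
    have s: "Re s > 0" using Re_bd[OF that] s0 by auto
    have int: "set_integrable lborel {0<..} (\<lambda>x. of_real x powr (s - 1) * h x)"
      by (rule mellin_integrable[OF assms s])
    have intI: "set_integrable lborel (I n) (\<lambda>x. of_real x powr (s - 1) * h x)"
      unfolding I_def by (rule borel_integrable_atLeastAtMost'[OF contI[unfolded I_def]])
    have "F n s = (LBINT x:I n. of_real x powr (s - 1) * h x)"
      unfolding F_def by (rule set_borel_integral_eq_integral(2)[OF intI, symmetric])
    moreover have eq: "(\<lambda>x. indicator {0<..} x *\<^sub>R (of_real x powr (s - 1) * h x) - indicator (I n) x *\<^sub>R (of_real x powr (s - 1) * h x))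
        = (\<lambda>x. indicator {0<..} x *\<^sub>R indicator (- I n) x *\<^sub>R (of_real x powr (s - 1) * h x))"
      using I_sub[of n] by (intro ext) (auto simp: indicator_def)
    ultimately have "mellin h s - F n s = (LBINT x. indicator {0<..} x *\<^sub>R indicator (- I n) x *\<^sub>R (of_real x powr (s - 1) * h x))"
      using Bochner_Integration.integral_diff[OF int[unfolded set_integrable_def] intI[unfolded set_integrable_def], unfolded eq]
      by (simp only: mellin_def set_lebesgue_integral_def)
    also have "norm \<dots> \<le> (LBINT x. indicator {0<..} x *\<^sub>R indicator (- I n) x *\<^sub>R b x)"
    proof (rule Bochner_Integration.integral_norm_bound_integral)
      show "integrable lborel (\<lambda>x. indicator {0<..} x *\<^sub>R indicator (- I n) x *\<^sub>R (of_real x powr (s - 1) * h x))"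
        using Bochner_Integration.integrable_diff[OF int[unfolded set_integrable_def] intI[unfolded set_integrable_def], unfolded eq] .
      show "integrable lborel (\<lambda>x. indicator {0<..} x *\<^sub>R indicator (- I n) x *\<^sub>R b x)"
        using E_int[of n] by (simp only: set_integrable_def)
    qed (use b_bd[OF _ that] in \<open>auto simp: indicator_def\<close>)
    finally show ?thesis by (simp add: E_def set_lebesgue_integral_def dist_norm norm_minus_commute)
  qed
  have "uniform_limit (cball s0 d) F (mellin h) sequentially"
  proof (rule uniform_limitI)
    fix e :: real assume "e > 0"
    with E_lim have "eventually (\<lambda>n. E n < e) sequentially" by (rule order_tendstoD)
    then show "eventually (\<lambda>n. \<forall>s\<in>cball s0 d. dist (F n s) (mellin h s) < e) sequentially"
      by eventually_elim (blast intro: le_less_trans diff)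
  qed
  moreover have "cball s0 d \<subseteq> {s. 0 < Re s}" using Re_bd s0 by force
  ultimately show "\<exists>d>0. cball s0 d \<subseteq> {s. 0 < Re s} \<and> uniform_limit (cball s0 d) F (mellin h) sequentially"
    using d by blast
qed

section \<open>The fundamental theorem and integration by parts on the half-line\<close>

lemma integral_Ioi_FTC:
  fixes F f :: "real \<Rightarrow> complex"
  assumes "\<And>x. x > 0 \<Longrightarrow> (F has_vector_derivative f x) (at x)"
    and "continuous_on {0<..} f" and "set_integrable lborel {0<..} f"
    and "(F \<longlongrightarrow> A) (at_right 0)" and "(F \<longlongrightarrow> B) at_top"
  shows "(LBINT x:{0<..}. f x) = B - A"
proof -
  have eint: "einterval 0 \<infinity> = {0<..}" by (auto simp: einterval_def)
  have "(LBINT x=0..\<infinity>. f x) = B - A"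
  proof (rule interval_integral_FTC_integrable)
    show "isCont f x" if "0 < ereal x" for x
      using assms(2) that by (auto simp: continuous_on_eq_continuous_at)
    show "((F \<circ> real_of_ereal) \<longlongrightarrow> A) (at_right 0)"
      using assms(4) by (simp add: zero_ereal_def ereal_tendsto_simps)
    show "((F \<circ> real_of_ereal) \<longlongrightarrow> B) (at_left \<infinity>)"
      using assms(5) by (simp add: ereal_tendsto_simps)
  qed (use assms in \<open>auto simp: eint\<close>)
  then show ?thesis by (simp add: interval_lebesgue_integral_def eint)
qed

lemma powr_exp_tendsto_0_at_top: "((\<lambda>x::real. x powr c * exp (- x)) \<longlongrightarrow> 0) at_top"
  by real_asymp

text \<open>The derivative of \<open>x powr s * h x\<close> integrates to 0: the product vanishes at
  0 because \<open>Re s > 0\<close>, and at infinity because of the exponential decay.\<close>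

lemma mellin_parts:
  assumes "continuous_on {0<..} h'" "\<And>x. x > 0 \<Longrightarrow> (h has_vector_derivative h' x) (at x)"
    "\<And>x. x > 0 \<Longrightarrow> norm (h x) \<le> K * exp (- x)" "\<And>x. x > 0 \<Longrightarrow> norm (h' x) \<le> K' * exp (- x)" "Re s > 0"
  shows "s * mellin h s = - mellin h' (s + 1)"
proof -
  have h: "continuous_on {0<..} h"
    using assms(2) by (auto intro!: continuous_at_imp_continuous_on dest: has_vector_derivative_continuous)
  have i1: "set_integrable lborel {0<..} (\<lambda>x. s * (of_real x powr (s - 1) * h x))"
    by (intro set_integrable_mult_right mellin_integrable[OF h assms(3,5)])
  have i2: "set_integrable lborel {0<..} (\<lambda>x. of_real x powr s * h' x)"
    using mellin_integrable[OF assms(1,4), of "s + 1"] assms(5) by simp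
  have nrm: "norm (of_real x powr s * h x) \<le> K * (x powr Re s * exp (- x))" if "x > 0" for x
    using mult_left_mono[OF assms(3)[OF that], of "x powr Re s"] that by (simp add: norm_mult norm_powr_pos mult_ac)
  have "(LBINT x:{0<..}. s * (of_real x powr (s - 1) * h x) + of_real x powr s * h' x) = 0 - 0"
  proof (rule integral_Ioi_FTC)
    show "((\<lambda>x. of_real x powr s * h x) has_vector_derivative s * (of_real x powr (s - 1) * h x) + of_real x powr s * h' x) (at x)"
      if "x > 0" for x
    proof -
      have "((\<lambda>x. of_real x powr s) has_vector_derivative s * of_real x powr (s - 1)) (at x)"
        using that by (auto intro!: derivative_eq_intros has_vector_derivative_real_field simp: powr_diff complex_nonpos_Reals_iff)
      from has_vector_derivative_mult[OF this assms(2)[OF that]] show ?thesis by (simp add: algebra_simps)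
    qed
    show "continuous_on {0<..} (\<lambda>x. s * (of_real x powr (s - 1) * h x) + of_real x powr s * h' x)"
      by (intro continuous_intros h assms)
    show "set_integrable lborel {0<..} (\<lambda>x. s * (of_real x powr (s - 1) * h x) + of_real x powr s * h' x)"
      by (intro set_integral_add i1 i2)
    have "((\<lambda>x::real. K * (x powr Re s * exp (- x))) \<longlongrightarrow> 0) (at_right 0)"
      using assms(5) by real_asymp
    then show "((\<lambda>x. of_real x powr s * h x) \<longlongrightarrow> 0) (at_right 0)"
      by (rule Lim_null_comparison[rotated]) (auto simp: eventually_at_right_field nrm intro!: exI[of _ 1])
    have "((\<lambda>x::real. K * (x powr Re s * exp (- x))) \<longlongrightarrow> 0) at_top"
      using tendsto_mult_right_zero[OF powr_exp_tendsto_0_at_top] by simp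
    then show "((\<lambda>x. of_real x powr s * h x) \<longlongrightarrow> 0) at_top"
      by (rule Lim_null_comparison[rotated]) (use nrm in \<open>auto intro: eventually_mono[OF eventually_gt_at_top[of 0]]\<close>)
  qed
  also have "(LBINT x:{0<..}. s * (of_real x powr (s - 1) * h x) + of_real x powr s * h' x) = s * mellin h s + mellin h' (s + 1)"
    by (subst set_integral_add(2)[OF i1 i2]) (simp add: mellin_def)
  finally show ?thesis by (simp add: add_eq_0_iff2)
qed

subsection \<open>The Mellin transform of \<open>1 / (1 + x\<^sup>2)\<close>\<close>

text \<open>The substitution \<open>x = sqrt (t / (1 - t))\<close> produces the Beta integral with
  parameters \<open>(1 + s) / 2\<close> and \<open>(1 - s) / 2\<close>. These sum to 1, so the
  reflection formula for Gamma evaluates it.\<close>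

lemma
  fixes s :: real
  assumes "-1 < s" "s < 1"
  shows set_integrable_powr_over_quadratic: "set_integrable lborel {0<..} (\<lambda>x::real. 2 * (x powr s / (1 + x\<^sup>2)))"
    and integral_powr_over_quadratic: "(LBINT x:{0::real<..}. 2 * (x powr s / (1 + x\<^sup>2))) = pi / cos (pi * s / 2)"
proof -
  define c where "c = (s + 1) / 2"
  have c: "0 < c" "c < 1" using assms by (auto simp: c_def)
  define f where "f = (\<lambda>x::real. 2 * (x powr s / (1 + x\<^sup>2)))"
  define b where "b = (\<lambda>t::real. t powr (c - 1) * (1 - t) powr (1 - c - 1))"
  \<comment> \<open>\<open>g\<close> inverts \<open>t = x\<^sup>2 / (1 + x\<^sup>2)\<close>, and
    \<open>g'\<close> is its derivative.\<close>
  define g where "g = (\<lambda>t::real. sqrt (t / (1 - t)))"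
  define g' where "g' = (\<lambda>t::real. 1 / (2 * sqrt (t / (1 - t)) * (1 - t)\<^sup>2))"
  have pos: "1 + x\<^sup>2 > 0" for x :: real by (simp add: add_pos_nonneg)
  have e0: "einterval 0 \<infinity> = {0<..}" by (auto simp: einterval_def)
  have e1: "einterval 0 1 = {0<..<1}" by (auto simp: einterval_def)
  have bi: "set_integrable lborel {0..1} b"
    using integrable_Beta[of c "1 - c"] c unfolding b_def by simp
  then have bi': "set_integrable lborel {0<..<1} b"
    by (rule set_integrable_subset) auto
  have eq: "f (g t) * g' t = b t" if "t > 0" "t < 1" for t
  proof -
    define r where "r = t / (1 - t)"
    have r: "r > 0" using that by (simp add: r_def)
    have "1 + (g t)\<^sup>2 = 1 / (1 - t)" using that r by (simp add: g_def field_simps)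
    then have "f (g t) * g' t = (sqrt r powr s / sqrt r) / (1 - t)"
      using that by (simp add: f_def g'_def g_def power2_eq_square flip: r_def)
    also have "sqrt r powr s / sqrt r = r powr (c - 1)"
      using r by (simp add: powr_half_sqrt[symmetric] powr_powr powr_diff[symmetric] c_def field_simps)
    also have "r powr (c - 1) / (1 - t) = t powr (c - 1) / ((1 - t) powr (c - 1) * (1 - t) powr 1)"
      using that by (simp add: r_def powr_divide)
    also have "(1 - t) powr (c - 1) * (1 - t) powr 1 = (1 - t) powr c"
      by (simp only: powr_add[symmetric]) simp
    also have "t powr (c - 1) / (1 - t) powr c = b t"
      by (simp add: b_def powr_minus divide_inverse)
    finally show ?thesis .
  qed
  have fg: "set_integrable lborel (einterval 0 1) (\<lambda>t. f (g t) * g' t)"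
    unfolding e1 using bi' by (rule set_integrable_cong[THEN iffD1, rotated -1]) (auto simp: eq)
  have D: "DERIV g t :> g' t" if "t > 0" "t < 1" for t
    unfolding g_def g'_def using that
    by (auto intro!: derivative_eq_intros simp: field_simps power2_eq_square)
  have g0: "((ereal \<circ> g \<circ> real_of_ereal) \<longlongrightarrow> 0) (at_right 0)"
  proof -
    have "(g \<longlongrightarrow> 0) (at_right 0)" unfolding g_def by real_asymp
    then show ?thesis by (simp add: zero_ereal_def ereal_tendsto_simps)
  qed
  have g1: "((ereal \<circ> g \<circ> real_of_ereal) \<longlongrightarrow> \<infinity>) (at_left 1)"
  proof -
    have "filterlim g at_top (at_left 1)" unfolding g_def by real_asymp
    then show ?thesis by (simp add: one_ereal_def ereal_tendsto_simps)
  qed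
  have contg': "isCont g' t" if "t > 0" "t < 1" for t
    unfolding g'_def using that by (intro continuous_intros) auto
  have contf: "isCont f (g t)" if "t > 0" "t < 1" for t
    unfolding f_def using pos[of "g t"] that by (intro continuous_intros) (auto simp: g_def)
  have *: "0 < ereal x \<longleftrightarrow> 0 < x" "ereal x < 1 \<longleftrightarrow> x < 1" "0 \<le> ereal x \<longleftrightarrow> 0 \<le> x" "ereal x \<le> 1 \<longleftrightarrow> x \<le> 1" for x
    by (simp_all add: zero_ereal_def one_ereal_def)
  have nn: "0 \<le> f x" "0 \<le> x \<Longrightarrow> x \<le> 1 \<Longrightarrow> 0 \<le> g' x" for x
    using pos[of x] by (auto simp: f_def g'_def)
  \<comment> \<open>As everything is nonnegative, the substitution rule derives the integrability of
    \<open>f\<close> from that of the Beta integrand.\<close>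
  have "set_integrable lborel (einterval 0 \<infinity>) f"
    by (rule interval_integral_substitution_nonneg(1)[OF _ _ _ _ _ _ g0 g1 fg]) (simp_all add: * D contg' contf nn)
  moreover have "(LBINT x=0..\<infinity>. f x) = (LBINT t=0..1. f (g t) * g' t)"
    by (rule interval_integral_substitution_nonneg(2)[OF _ _ _ _ _ _ g0 g1 fg]) (simp_all add: * D contg' contf nn)
  ultimately have 1: "set_integrable lborel {0<..} f" "(LBINT x:{0<..}. f x) = (LBINT t:{0<..<1}. f (g t) * g' t)"
    by (simp_all add: interval_lebesgue_integral_def e0 e1)
  show "set_integrable lborel {0<..} (\<lambda>x::real. 2 * (x powr s / (1 + x\<^sup>2)))"
    using 1(1) unfolding f_def .
  have "(LBINT t:{0<..<1}. f (g t) * g' t) = (LBINT t:{0<..<1}. b t)"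
    by (intro set_lebesgue_integral_cong) (auto simp: eq)
  also have "\<dots> = integral {0<..<1} b" by (rule set_borel_integral_eq_integral(2)[OF bi'])
  also have "\<dots> = Beta c (1 - c)"
    using has_integral_Beta_real[of c "1 - c"] c
    by (intro integral_unique) (simp add: b_def has_integral_Icc_iff_Ioo)
  also have "\<dots> = pi / sin (pi * c)"
  proof -
    have "sin (complex_of_real pi * of_real c) = of_real (sin (pi * c))"
      by (simp only: sin_of_real of_real_mult[symmetric])
    then have "complex_of_real (Gamma c * Gamma (1 - c)) = of_real (pi / sin (pi * c))"
      using Gamma_reflection_complex[of "of_real c"] by (simp flip: Gamma_complex_of_real)
    then have "Gamma c * Gamma (1 - c) = pi / sin (pi * c)" by (simp only: of_real_eq_iff)
    then show ?thesis by (simp add: Beta_def)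
  qed
  also have "sin (pi * c) = cos (pi * s / 2)"
  proof -
    have "pi * c = pi / 2 + pi * s / 2" by (simp add: c_def field_simps)
    then show ?thesis by (simp only: sin_add sin_pi_half cos_pi_half mult_1 mult_zero_left add_0_right)
  qed
  finally have "(LBINT x:{0<..}. f x) = pi / cos (pi * s / 2)"
    using 1(2) by (rule trans[rotated])
  then show "(LBINT x:{0::real<..}. 2 * (x powr s / (1 + x\<^sup>2))) = pi / cos (pi * s / 2)"
    unfolding f_def .
qed

subsection \<open>Partial fractions\<close>

text \<open>This is the logarithmic derivative of the reflection formula
  \<open>Gamma z * Gamma (1 - z) = pi / sin (pi * z)\<close>.\<close>

lemma Digamma_reflection_complex:
  fixes z :: complex
  assumes "z \<notin> \<int>"
  shows "Digamma (1 - z) - Digamma z = of_real pi * cot (of_real pi * z)"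
proof -
  have z: "z \<notin> \<int>\<^sub>\<le>\<^sub>0" using assms by (auto elim!: nonpos_Ints_cases)
  have z': "1 - z \<notin> \<int>\<^sub>\<le>\<^sub>0" using assms
    by (metis Ints_1 Ints_diff diff_add_cancel add_diff_cancel_left' nonpos_Ints_Int)
  have sin: "sin (of_real pi * z) \<noteq> 0"
    using assms by (auto simp: sin_eq_0)
  define s where "s = sin (of_real pi * z)"
  define c where "c = cos (of_real pi * z)"
  have "((\<lambda>z. Gamma z * Gamma (1 - z)) has_field_derivative
      Gamma z * Gamma (1 - z) * (Digamma z - Digamma (1 - z))) (at z)"
    using z z' by (auto intro!: derivative_eq_intros simp: algebra_simps)
  moreover have "(\<lambda>z::complex. Gamma z * Gamma (1 - z)) = (\<lambda>z. of_real pi / sin (of_real pi * z))"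
    by (intro ext Gamma_reflection_complex)
  moreover have "((\<lambda>z. of_real pi / sin (of_real pi * z)) has_field_derivative
      - (of_real pi / s) * of_real pi * c / s) (at z)"
    using sin by (auto intro!: derivative_eq_intros simp: s_def c_def field_simps)
  ultimately have "Gamma z * Gamma (1 - z) * (Digamma z - Digamma (1 - z)) = - (of_real pi / s) * of_real pi * c / s"
    using DERIV_unique by metis
  then have "of_real pi / s * (Digamma z - Digamma (1 - z)) = of_real pi / s * (- of_real pi * c / s)"
    by (subst (asm) Gamma_reflection_complex) (simp add: s_def)
  then have "Digamma z - Digamma (1 - z) = - of_real pi * c / s"
    using sin unfolding s_def[symmetric] by (subst (asm) mult_cancel_left) auto
  then show ?thesis by (simp add: cot_def s_def c_def algebra_simps minus_equation_iff)
qed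

text \<open>In the difference of the two Digamma series the terms \<open>1 / Suc n\<close> and the
  Euler-Mascheroni constant cancel. Pairing \<open>z + n\<close> with \<open>1 - z + n\<close> folds
  the two-sided sum over the poles into a convergent series over \<open>nat\<close>.\<close>

lemma cot_partial_fractions:
  fixes z :: complex
  assumes "z \<notin> \<int>"
  shows "(\<lambda>n. 1 / (z + of_nat n) - 1 / (1 - z + of_nat n)) sums (of_real pi * cot (of_real pi * z))"
proof -
  have "z \<noteq> 0" "1 - z \<noteq> 0" using assms by auto
  then have "(\<lambda>n. inverse (of_nat (Suc n)) - inverse (1 - z + of_nat n)) sums (Digamma (1 - z) + euler_mascheroni)"
    "(\<lambda>n. inverse (of_nat (Suc n)) - inverse (z + of_nat n)) sums (Digamma z + euler_mascheroni)"
    using summable_sums[OF summable_Digamma[of z]] summable_sums[OF summable_Digamma[of "1 - z"]]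
    by (simp_all add: Digamma_def)
  from sums_diff[OF this] show ?thesis
    by (simp add: Digamma_reflection_complex[OF assms, symmetric] inverse_eq_divide add_ac)
qed

section \<open>The kernel \<open>z / (exp x - z)\<close> on the unit circle and its cotangent
  form\<close>

definition root_at :: "real \<Rightarrow> complex" where
  "root_at a = exp (2 * of_real pi * \<i> * of_real a)"

lemma norm_root_at [simp]: "norm (root_at a) = 1"
  by (simp add: root_at_def)

lemma root_at_nonzero [simp]: "root_at a \<noteq> 0"
  by (simp add: root_at_def)

lemma root_at_neq_1:
  assumes "0 < a" "a < 1"
  shows "root_at a \<noteq> 1"
proof
  assume "root_at a = 1"
  then obtain n :: int where "2 * pi * a = of_int (2 * n) * pi" by (auto simp: exp_eq_1 root_at_def)
  then have "a = of_int n" by simp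
  with assms show False by simp
qed

lemma root_at_conv_cis: "root_at a = cis (2 * pi * a)"
  by (simp add: root_at_def cis_conv_exp mult_ac)

lemma root_at_reflect: "root_at (1 - a) = cnj (root_at a)"
proof -
  have "root_at (1 - a) = cis (2 * pi - 2 * pi * a)" by (simp add: root_at_conv_cis algebra_simps)
  also have "\<dots> = cis (2 * pi) * cis (- (2 * pi * a))" by (simp only: cis_mult) simp
  finally show ?thesis by (simp add: root_at_conv_cis cis_cnj)
qed

text \<open>For \<open>x > 0\<close> and \<open>norm z = 1\<close> this is the geometric series with
  terms \<open>z ^ n * exp (- n * x)\<close>, \<open>n \<ge> 1\<close>; its termwise Mellin
  transform is Gamma times the polylogarithm.\<close>

definition polylog_kernel :: "complex \<Rightarrow> real \<Rightarrow> complex" where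
  "polylog_kernel z x = z / (of_real (exp x) - z)"

text \<open>With \<open>w\<close> the argument of the cotangent, \<open>exp (2 * \<i> * w)\<close>
  equals \<open>root_at a / exp x\<close>, and both sides are the same rational function of this
  exponential.\<close>

lemma polylog_kernel_cot:
  assumes "x > 0"
  shows "polylog_kernel (root_at a) x
    = - 1 / 2 + \<i> / 2 * cot (of_real pi * (of_real a + \<i> * of_real (x / (2 * pi))))"
proof -
  define z where "z = root_at a"
  define e where "e = complex_of_real (exp x)"
  define w where "w = of_real pi * (of_real a + \<i> * of_real (x / (2 * pi)))"
  define E where "E = exp (\<i> * w)"
  have E: "E \<noteq> 0" by (simp add: E_def)
  have e: "e \<noteq> 0" by (simp add: e_def)
  have "E\<^sup>2 = exp (2 * (\<i> * w))" by (simp add: E_def exp_double)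
  also have "2 * (\<i> * w) = 2 * of_real pi * \<i> * of_real a - of_real x"
    by (simp add: w_def field_simps)
  also have "exp \<dots> = z / e" by (simp add: exp_diff z_def root_at_def e_def exp_of_real)
  finally have E2: "E\<^sup>2 = z / e" .
  have "norm z = 1" by (simp add: z_def)
  moreover have "norm e > 1" using assms by (simp add: e_def)
  ultimately have ne: "e \<noteq> z" by auto
  then have ne2: "E\<^sup>2 \<noteq> 1" using e by (auto simp: E2)
  have "sin w = (E\<^sup>2 - 1) / (2 * \<i> * E)" "cos w = (E\<^sup>2 + 1) / (2 * E)"
    using E by (simp_all add: sin_exp_eq cos_exp_eq flip: E_def)
      (simp_all add: E_def exp_minus divide_simps power2_eq_square, simp_all add: algebra_simps)
  then have "cot w = \<i> * ((E\<^sup>2 + 1) / (E\<^sup>2 - 1))"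
    using E ne2 by (simp only: cot_def) (simp add: field_simps)
  then have "- 1 / 2 + \<i> / 2 * cot w = - 1 / 2 - (E\<^sup>2 + 1) / (2 * (E\<^sup>2 - 1))"
    by (simp add: mult.assoc[symmetric])
  also have "\<dots> = z / (e - z)"
    unfolding E2 using e ne by (simp add: divide_simps) (simp add: algebra_simps)
  finally show ?thesis by (simp add: polylog_kernel_def z_def e_def w_def)
qed

text \<open>The kernels at \<open>a\<close> and \<open>1 - a\<close> contribute
  \<open>- 1 / 2\<close> each, which the summand 1 cancels; there remains a sum of two cotangents,
  expanded by \<open>cot_partial_fractions\<close>.\<close>

lemma polylog_kernel_partial_fractions:
  assumes "x > 0" "0 < a" "a < 1"
  shows "(\<lambda>n. complex_of_real (2 * x / (x\<^sup>2 + (2 * pi * (real n + a))\<^sup>2) + 2 * x / (x\<^sup>2 + (2 * pi * (real n + (1 - a)))\<^sup>2)))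
    sums (1 + polylog_kernel (root_at a) x
            + polylog_kernel (root_at (1 - a)) x)"
proof -
  define y where "y = x / (2 * pi)"
  define u where "u = complex_of_real a + \<i> * of_real y"
  define v where "v = complex_of_real (1 - a) + \<i> * of_real y"
  have y: "y > 0" using assms by (simp add: y_def)
  have "u \<notin> \<int>" "v \<notin> \<int>" using y by (auto simp: u_def v_def complex_is_Int_iff)
  then have s: "(\<lambda>n. \<i> / (2 * of_real pi) * ((1 / (u + of_nat n) - 1 / (1 - u + of_nat n)) + (1 / (v + of_nat n) - 1 / (1 - v + of_nat n))))
     sums (\<i> / (2 * of_real pi) * (of_real pi * cot (of_real pi * u) + of_real pi * cot (of_real pi * v)))"
    by (intro sums_mult sums_add cot_partial_fractions)
  have *: "1 / (complex_of_real b + \<i> * of_real y) - 1 / (complex_of_real b - \<i> * of_real y) = - 2 * \<i> * of_real (y / (b\<^sup>2 + y\<^sup>2))"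
    if "b > 0" for b
  proof -
    have "complex_of_real b + \<i> * of_real y \<noteq> 0" "complex_of_real b - \<i> * of_real y \<noteq> 0"
      using that by (auto simp: complex_eq_iff)
    moreover have "(complex_of_real b + \<i> * of_real y) * (complex_of_real b - \<i> * of_real y) = of_real (b\<^sup>2 + y\<^sup>2)"
      by (simp add: algebra_simps power2_eq_square)
    moreover have "complex_of_real (b\<^sup>2 + y\<^sup>2) \<noteq> 0" using that y
      by (metis of_real_eq_0_iff sum_power2_eq_zero_iff less_irrefl)
    ultimately have "1 / (complex_of_real b + \<i> * of_real y) - 1 / (complex_of_real b - \<i> * of_real y)
       = ((complex_of_real b - \<i> * of_real y) - (complex_of_real b + \<i> * of_real y)) / of_real (b\<^sup>2 + y\<^sup>2)"
      by (metis diff_frac_eq mult_1)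
    then show ?thesis by (simp add: field_simps)
  qed
  have aux: "\<i> / (2 * of_real pi) * (- 2 * \<i> * of_real p + - 2 * \<i> * of_real q) = complex_of_real (1 / pi * p + 1 / pi * q)" for p q
    by (simp add: field_simps)
  have conv: "1 / pi * (y / (b\<^sup>2 + y\<^sup>2)) = 2 * x / (x\<^sup>2 + (2 * pi * b)\<^sup>2)" for b
  proof -
    have "b\<^sup>2 + y\<^sup>2 > 0" using y by (simp add: add_nonneg_pos)
    moreover have "x = 2 * pi * y" by (simp add: y_def)
    moreover have "x\<^sup>2 + (2 * pi * b)\<^sup>2 = 4 * pi\<^sup>2 * (b\<^sup>2 + y\<^sup>2)"
      unfolding \<open>x = 2 * pi * y\<close> by (simp add: algebra_simps power2_eq_square)
    ultimately show ?thesis by (simp add: divide_simps power2_eq_square)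
  qed
  have trm: "\<i> / (2 * of_real pi) * ((1 / (u + of_nat n) - 1 / (1 - u + of_nat n)) + (1 / (v + of_nat n) - 1 / (1 - v + of_nat n)))
     = complex_of_real (2 * x / (x\<^sup>2 + (2 * pi * (real n + a))\<^sup>2) + 2 * x / (x\<^sup>2 + (2 * pi * (real n + (1 - a)))\<^sup>2))" (is "?l = _") for n
  proof -
    \<comment> \<open>As \<open>1 - u = (1 - a) - \<i> * y\<close> and
      \<open>1 - v = a - \<i> * y\<close>, exchanging the two subtracted fractions pairs each
      fraction with its complex conjugate.\<close>
    have "?l = \<i> / (2 * of_real pi) * ((1 / (of_real (real n + a) + \<i> * of_real y) - 1 / (of_real (real n + a) - \<i> * of_real y))
       + (1 / (of_real (real n + (1 - a)) + \<i> * of_real y) - 1 / (of_real (real n + (1 - a)) - \<i> * of_real y)))"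
      by (simp add: u_def v_def algebra_simps)
    also have "\<dots> = complex_of_real (1 / pi * (y / ((real n + a)\<^sup>2 + y\<^sup>2)) + 1 / pi * (y / ((real n + (1 - a))\<^sup>2 + y\<^sup>2)))"
      using assms by (subst (1 2) *) (auto simp only: aux intro: add_nonneg_pos)
    finally show ?thesis unfolding conv .
  qed
  have "\<i> / (2 * of_real pi) * (of_real pi * cot (of_real pi * u) + of_real pi * cot (of_real pi * v))
    = 1 + polylog_kernel (root_at a) x
            + polylog_kernel (root_at (1 - a)) x"
    unfolding polylog_kernel_cot[OF assms(1)] u_def v_def y_def by (simp add: field_simps)
  with s show ?thesis unfolding trm by simp
qed

subsection \<open>Analytic continuation of the polylogarithm\<close>

text \<open>After division by \<open>exp x\<close> the quantity is \<open>1 - z * t\<close> with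
  \<open>t = exp (- x)\<close>. Its modulus attains a minimum on \<open>{0..1}\<close>, which is
  positive because \<open>z * t = 1\<close> forces \<open>t = 1\<close> and
  \<open>z = 1\<close>.\<close>

lemma exp_minus_unit_lower_bound:
  fixes z :: complex
  assumes "norm z = 1" "z \<noteq> 1"
  obtains d where "d > 0" "\<And>x. x \<ge> 0 \<Longrightarrow> norm (of_real (exp x) - z) \<ge> d * exp x"
proof -
  have "continuous_on {0..1::real} (\<lambda>t. norm (1 - z * of_real t))" by (intro continuous_intros)
  then obtain t0 where t0: "t0 \<in> {0..1::real}" "\<And>t. t \<in> {0..1} \<Longrightarrow> norm (1 - z * of_real t0) \<le> norm (1 - z * of_real t)"
    using continuous_attains_inf[of "{0..1::real}" "\<lambda>t. norm (1 - z * of_real t)"] by auto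
  define d where "d = norm (1 - z * of_real t0)"
  have "1 \<noteq> z * of_real t0"
  proof
    assume *: "1 = z * of_real t0"
    then have "norm (z * of_real t0) = 1" by (metis norm_one)
    then have "t0 = 1" using assms t0(1) by (simp add: norm_mult)
    with * assms show False by simp
  qed
  then have "d > 0" by (simp add: d_def)
  moreover have "norm (of_real (exp x) - z) \<ge> d * exp x" if "x \<ge> 0" for x
  proof -
    have "d \<le> norm (1 - z * of_real (exp (- x)))" unfolding d_def using that by (intro t0) auto
    then have "d * exp x \<le> norm (1 - z * of_real (exp (- x))) * norm (complex_of_real (exp x))" by simp
    also have "\<dots> = norm ((1 - z * of_real (exp (- x))) * of_real (exp x))" by (simp only: norm_mult)
    also have "(1 - z * of_real (exp (- x))) * of_real (exp x) = of_real (exp x) - z"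
      by (simp add: left_diff_distrib mult.assoc exp_minus flip: of_real_mult)
    finally show ?thesis .
  qed
  ultimately show ?thesis by (rule that)
qed

lemma exp_neq_unit:
  assumes "norm z = 1" "z \<noteq> 1" "x \<ge> 0"
  shows "complex_of_real (exp x) \<noteq> z"
proof
  assume *: "complex_of_real (exp x) = z"
  then have "exp x = 1" using assms(1) by (metis norm_of_real abs_of_pos exp_gt_zero)
  with * assms(2) show False by simp
qed

text \<open>Since \<open>- f' = f + f\<^sup>2\<close>, the \<open>k\<close>-th iterate of \<open>- d/dx\<close> maps \<open>f\<close> to the polynomial \<open>polylog_poly k\<close> in \<open>f\<close>.\<close>
fun polylog_poly :: "nat \<Rightarrow> complex poly" where
  "polylog_poly 0 = [:0, 1:]"
| "polylog_poly (Suc k) = [:0, 1, 1:] * pderiv (polylog_poly k)"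

lemma poly_polylog_poly_0: "poly (polylog_poly k) 0 = 0"
  by (cases k) auto

text \<open>Up to the sign \<open>(- 1) ^ k\<close> this is the \<open>k\<close>-th derivative of
  the kernel; the sign keeps repeated integration by parts free of alternating factors.\<close>

definition polylog_deriv :: "complex \<Rightarrow> nat \<Rightarrow> real \<Rightarrow> complex" where
  "polylog_deriv z k x = poly (polylog_poly k) (polylog_kernel z x)"

lemma polylog_deriv_0: "polylog_deriv z 0 = polylog_kernel z"
  by (simp add: fun_eq_iff polylog_deriv_def)

context
  fixes z :: complex
  assumes z: "norm z = 1" "z \<noteq> 1"
begin

text \<open>The endpoint 0 is included because \<open>z \<noteq> 1\<close>; the value of the kernel
  there enters the computation of \<open>P 0 a\<close>.\<close>

lemma polylog_kernel_has_derivative: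
  assumes "x \<ge> 0"
  shows "(polylog_kernel z has_vector_derivative - (polylog_kernel z x + polylog_kernel z x ^ 2)) (at x)"
proof -
  have nz: "complex_of_real (exp x) - z \<noteq> 0" using exp_neq_unit[OF z assms] by simp
  have "((\<lambda>x. complex_of_real (exp x)) has_vector_derivative of_real (exp x)) (at x)"
    by (intro has_vector_derivative_of_real) (auto intro!: derivative_eq_intros simp flip: has_real_derivative_iff_has_vector_derivative)
  then have "((\<lambda>x. complex_of_real (exp x) - z) has_vector_derivative of_real (exp x)) (at x)"
    by (auto intro!: derivative_eq_intros)
  moreover have "((\<lambda>w. z / w) has_field_derivative - z / (of_real (exp x) - z)^2) (at (of_real (exp x) - z))"
    using nz by (auto intro!: derivative_eq_intros simp: power2_eq_square)
  ultimately have "((\<lambda>w. z / w) \<circ> (\<lambda>x. complex_of_real (exp x) - z) has_vector_derivative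
      of_real (exp x) * (- z / (of_real (exp x) - z)^2)) (at x)"
    by (intro field_vector_diff_chain_at)
  moreover have "(\<lambda>w. z / w) \<circ> (\<lambda>x. complex_of_real (exp x) - z) = polylog_kernel z"
    by (simp add: fun_eq_iff polylog_kernel_def)
  moreover have "of_real (exp x) * (- z / (of_real (exp x) - z)^2) = - (polylog_kernel z x + polylog_kernel z x ^ 2)"
    using nz by (simp add: polylog_kernel_def divide_simps power2_eq_square) (simp add: algebra_simps)
  ultimately show ?thesis by simp
qed

lemma polylog_deriv_has_derivative:
  assumes "x \<ge> 0"
  shows "(polylog_deriv z k has_vector_derivative - polylog_deriv z (Suc k) x) (at x)"
proof -
  have "(poly (polylog_poly k) \<circ> polylog_kernel z has_vector_derivative
     - (polylog_kernel z x + polylog_kernel z x ^ 2) * poly (pderiv (polylog_poly k)) (polylog_kernel z x)) (at x)"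
    by (intro field_vector_diff_chain_at polylog_kernel_has_derivative assms poly_DERIV)
  moreover have "poly (polylog_poly k) \<circ> polylog_kernel z = polylog_deriv z k"
    by (simp add: fun_eq_iff polylog_deriv_def)
  ultimately show ?thesis by (simp add: polylog_deriv_def algebra_simps power2_eq_square)
qed

lemma polylog_deriv_isCont: "x \<ge> 0 \<Longrightarrow> isCont (polylog_deriv z k) x"
  by (rule has_vector_derivative_continuous[OF polylog_deriv_has_derivative])

lemma polylog_deriv_continuous: "continuous_on {0<..} (polylog_deriv z k)"
  by (intro continuous_at_imp_continuous_on ballI polylog_deriv_isCont) auto

text \<open>The polynomial vanishes at 0, so one factor of the kernel splits off and supplies the
  decay; the cofactor is bounded on a compact disc that contains all kernel values.\<close>

lemma polylog_deriv_bound: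
  obtains C where "\<And>x. x > 0 \<Longrightarrow> norm (polylog_deriv z k x) \<le> C * exp (- x)"
proof -
  obtain d where d: "d > 0" "\<And>x. x \<ge> 0 \<Longrightarrow> norm (of_real (exp x) - z) \<ge> d * exp x"
    using exp_minus_unit_lower_bound[OF z] by blast
  have kb: "norm (polylog_kernel z x) \<le> exp (- x) / d" if "x > 0" for x
  proof -
    have "0 < d * exp x" using d(1) by simp
    then have "1 / norm (of_real (exp x) - z) \<le> 1 / (d * exp x)"
      using d(2)[of x] that by (intro frac_le) auto
    moreover have "norm (polylog_kernel z x) = 1 / norm (of_real (exp x) - z)"
      using z by (simp add: polylog_kernel_def norm_divide)
    moreover have "1 / (d * exp x) = exp (- x) / d" by (simp add: exp_minus field_simps)
    ultimately show ?thesis by simp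
  qed
  obtain r where r: "polylog_poly k = [:0, 1:] * r"
    using poly_polylog_poly_0[of k] by (auto simp: poly_eq_0_iff_dvd elim: dvdE)
  have "compact (poly r ` cball 0 (1 / d))"
    by (intro compact_continuous_image continuous_intros) auto
  then obtain R where "\<forall>w\<in>cball 0 (1 / d). norm (poly r w) \<le> R"
    by (auto dest!: compact_imp_bounded simp: bounded_iff)
  then have R: "\<And>w. norm w \<le> 1 / d \<Longrightarrow> norm (poly r w) \<le> R" by simp
  have "norm (polylog_deriv z k x) \<le> R / d * exp (- x)" if "x > 0" for x
  proof -
    have "exp (- x) / d \<le> 1 / d" using that d(1) by (intro divide_right_mono) auto
    then have "norm (polylog_kernel z x) \<le> 1 / d" using kb[OF that] by linarith
    then have "norm (polylog_kernel z x) * norm (poly r (polylog_kernel z x)) \<le> exp (- x) / d * R"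
      using kb[OF that] d(1) by (intro mult_mono R) auto
    then show ?thesis by (simp add: polylog_deriv_def r norm_mult mult_ac)
  qed
  then show ?thesis by (rule that)
qed

text \<open>Integration by parts produces a factor \<open>s\<close>, which
  \<open>rGamma s = s * rGamma (s + 1)\<close> absorbs. This invariance makes the continuations to
  different half-planes agree.\<close>

lemma polylog_mellin_step:
  assumes "Re s > 0"
  shows "rGamma s * mellin (polylog_deriv z k) s = rGamma (s + 1) * mellin (polylog_deriv z (Suc k)) (s + 1)"
proof -
  obtain C where C: "\<And>x. x > 0 \<Longrightarrow> norm (polylog_deriv z k x) \<le> C * exp (- x)" using polylog_deriv_bound[of k] by blast
  obtain C' where C': "\<And>x. x > 0 \<Longrightarrow> norm (polylog_deriv z (Suc k) x) \<le> C' * exp (- x)" using polylog_deriv_bound[of "Suc k"] by blast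
  have "s * mellin (polylog_deriv z k) s = - mellin (\<lambda>x. - polylog_deriv z (Suc k) x) (s + 1)"
    by (rule mellin_parts[OF _ _ C])
       (use C' assms in \<open>auto intro!: continuous_intros polylog_deriv_continuous polylog_deriv_has_derivative\<close>)
  also have "mellin (\<lambda>x. - polylog_deriv z (Suc k) x) (s + 1) = - mellin (polylog_deriv z (Suc k)) (s + 1)"
    by (simp add: mellin_def set_lebesgue_integral_def)
  finally have "s * mellin (polylog_deriv z k) s = mellin (polylog_deriv z (Suc k)) (s + 1)" by simp
  moreover have "rGamma s = s * rGamma (s + 1)" by (simp add: rGamma_plus1)
  ultimately show ?thesis by (simp add: mult_ac)
qed

lemma polylog_mellin_steps:
  assumes "Re s > - real k"
  shows "rGamma (s + of_nat k) * mellin (polylog_deriv z k) (s + of_nat k)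
       = rGamma (s + of_nat (k + j)) * mellin (polylog_deriv z (k + j)) (s + of_nat (k + j))"
proof (induction j)
  case (Suc j)
  then show ?case
    using polylog_mellin_step[of "s + of_nat (k + j)" "k + j"] assms by (simp add: add_ac)
qed auto

end

text \<open>Any \<open>k > - Re s\<close> would give the same value (lemma \<open>polylog_eq\<close>).\<close>
definition polylog :: "complex \<Rightarrow> complex \<Rightarrow> complex" where
  "polylog z s = (let k = nat \<lceil>1 - Re s\<rceil> in rGamma (s + of_nat k) * mellin (polylog_deriv z k) (s + of_nat k))"

lemma polylog_eq:
  assumes "norm z = 1" "z \<noteq> 1" "Re s > - real k"
  shows "polylog z s = rGamma (s + of_nat k) * mellin (polylog_deriv z k) (s + of_nat k)"
proof -
  define m where "m = nat \<lceil>1 - Re s\<rceil>"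
  have m: "Re s > - real m" unfolding m_def by linarith
  \<comment> \<open>Both indices \<open>k\<close> and \<open>m\<close> are raised to their sum,
    where the two expressions coincide.\<close>
  show ?thesis
    using polylog_mellin_steps[OF assms, of "m"] polylog_mellin_steps[OF assms(1,2) m, of "k"]
    by (simp add: polylog_def Let_def m_def[symmetric] add.commute[of m k])
qed

text \<open>On \<open>Re s > - real k\<close> a single index \<open>k\<close> describes the
  function, and these half-planes cover the plane.\<close>

lemma polylog_holomorphic:
  assumes "norm z = 1" "z \<noteq> 1"
  shows "polylog z holomorphic_on UNIV"
proof -
  have "polylog z holomorphic_on {s. Re s > - real k}" for k
  proof -
    obtain C where C: "\<And>x. x > 0 \<Longrightarrow> norm (polylog_deriv z k x) \<le> C * exp (- x)"
      using polylog_deriv_bound[OF assms] by blast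
    have "mellin (polylog_deriv z k) holomorphic_on {s. Re s > 0}"
      by (rule mellin_holomorphic[OF polylog_deriv_continuous[OF assms] C])
    then have "(\<lambda>s. mellin (polylog_deriv z k) (s + of_nat k)) holomorphic_on {s. Re s > - real k}"
      by (rule holomorphic_on_compose_gen[unfolded o_def, rotated]) (auto intro!: holomorphic_intros)
    then have "(\<lambda>s. rGamma (s + of_nat k) * mellin (polylog_deriv z k) (s + of_nat k)) holomorphic_on {s. Re s > - real k}"
      by (intro holomorphic_intros) auto
    then show ?thesis by (rule holomorphic_transform) (simp add: polylog_eq[OF assms])
  qed
  then have "polylog z holomorphic_on (\<Union>k. {s. Re s > - real k})"
    by (intro holomorphic_on_UN_open) (auto simp: open_halfspace_Re_gt)
  moreover have "(\<Union>k. {s. Re s > - real k}) = UNIV"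
  proof -
    have "\<exists>k. Re s > - real k" for s using reals_Archimedean2[of "- Re s"] by (auto simp: minus_less_iff)
    then show ?thesis by auto
  qed
  ultimately show ?thesis by simp
qed

section \<open>Agreement with the Dirichlet series for \<open>Re s > 1\<close>\<close>

lemma mellin_polylog_kernel_sums:
  assumes "norm z = 1" "z \<noteq> 1" "Re s > 1"
  shows "(\<lambda>n. z ^ Suc n * (Gamma s * of_nat (Suc n) powr - s)) sums mellin (polylog_kernel z) s"
proof -
  define f where "f = (\<lambda>n x. z ^ Suc n * (indicator {0<..} x *\<^sub>R (complex_of_real x powr (s - 1) * of_real (exp (- (real (Suc n) * x))))))"
  have int: "integrable lborel (f n)" for n
    using set_integrable_powr_exp_complex[of s "real (Suc n)"] assms(3)
    unfolding f_def set_integrable_def by (intro integrable_mult_right) auto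
  have ifn: "integral\<^sup>L lborel (f n) = z ^ Suc n * (Gamma s * of_nat (Suc n) powr - s)" for n
    using integral_powr_exp_complex[of s "real (Suc n)"] assms(3)
    unfolding f_def set_lebesgue_integral_def by (subst integral_mult_right_zero) (simp del: of_nat_Suc)
  have nf: "norm (f n x) = indicator {0<..} x *\<^sub>R (x powr (Re s - 1) * exp (- (real (Suc n) * x)))" for n x
    using assms(1) by (cases "x > 0") (auto simp: f_def norm_mult norm_power norm_powr_pos)
  have ifn': "(LBINT x. norm (f n x)) = Gamma (Re s) * real (Suc n) powr - Re s" for n
    unfolding nf using integral_powr_exp[of "Re s" "real (Suc n)"] assms(3)
    by (simp add: set_lebesgue_integral_def del: of_nat_Suc)
  have geo: "(\<lambda>n. z ^ Suc n * of_real (exp (- (real (Suc n) * x)))) sums polylog_kernel z x" if "x > 0" for x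
  proof -
    define w where "w = z * of_real (exp (- x))"
    have "norm w < 1" using assms(1) that by (simp add: w_def norm_mult)
    then have "(\<lambda>n. w * w ^ n) sums (w * (1 / (1 - w)))" by (intro sums_mult geometric_sums)
    moreover have "w * w ^ n = z ^ Suc n * of_real (exp (- (real (Suc n) * x)))" for n
    proof -
      have "exp (- (real (Suc n) * x)) = exp (- x) ^ Suc n" by (simp only: exp_of_nat_mult[symmetric]) simp
      then show ?thesis by (simp add: w_def power_mult_distrib)
    qed
    moreover have "w * (1 / (1 - w)) = polylog_kernel z x"
    proof -
      have e: "complex_of_real (exp x) \<noteq> 0" by simp
      have "w = z / of_real (exp x)" by (simp add: w_def exp_minus divide_inverse)
      then have zw: "z = of_real (exp x) * w" by simp
      then have "of_real (exp x) - z = of_real (exp x) * (1 - w)" by (simp add: right_diff_distrib)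
      then have "polylog_kernel z x = (of_real (exp x) * w) / (of_real (exp x) * (1 - w))"
        using zw unfolding polylog_kernel_def by (rule arg_cong2[where f = "(/)", rotated])
      then show ?thesis using e by simp
    qed
    ultimately show ?thesis by simp
  qed
  have fs: "(\<lambda>n. f n x) sums (indicator {0<..} x *\<^sub>R (of_real x powr (s - 1) * polylog_kernel z x))" for x
  proof (cases "x > 0")
    case True
    from sums_mult[OF geo[OF this], of "of_real x powr (s - 1)"] True show ?thesis
      by (simp add: f_def mult_ac)
  qed (simp add: f_def)
  \<comment> \<open>Sum and integral may be exchanged because the L1 norms
    \<open>Gamma (Re s) * real (Suc n) powr - Re s\<close> are summable for
    \<open>Re s > 1\<close>.\<close>
  have "(\<lambda>n. integral\<^sup>L lborel (f n)) sums (LBINT x. (\<Sum>n. f n x))"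
  proof (rule sums_integral[OF int])
    show "AE x in lborel. summable (\<lambda>n. norm (f n x))"
    proof (rule AE_I2)
      fix x :: real
      show "summable (\<lambda>n. norm (f n x))"
      proof (cases "x > 0")
        case True
        have "summable (\<lambda>n. x powr (Re s - 1) * exp (- x) * exp (- x) ^ n)"
          using True by (intro summable_mult summable_geometric) auto
        moreover have "exp (- x) * exp (- x) ^ n = exp (- (real (Suc n) * x))" for n
          by (simp only: power_Suc[symmetric], simp only: exp_of_nat_mult[symmetric], simp)
        ultimately show ?thesis using True by (simp add: nf mult.assoc)
      qed (simp add: f_def)
    qed
    have "summable (\<lambda>n. real (Suc n) powr - Re s)"
      using assms(3) by (subst summable_Suc_iff) (simp add: summable_real_powr_iff)
    then show "summable (\<lambda>n. LBINT x. norm (f n x))"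
      unfolding ifn' by (rule summable_mult)
  qed
  also have "(LBINT x. (\<Sum>n. f n x)) = mellin (polylog_kernel z) s"
    unfolding mellin_def set_lebesgue_integral_def using fs by (simp add: sums_iff)
  finally show ?thesis unfolding ifn .
qed

lemma polylog_sums:
  assumes "norm z = 1" "z \<noteq> 1" "Re s > 1"
  shows "(\<lambda>n. z ^ Suc n * of_nat (Suc n) powr - s) sums polylog z s"
proof -
  have "s \<notin> \<int>\<^sub>\<le>\<^sub>0" using assms(3) by (auto elim!: nonpos_Ints_cases)
  then have "rGamma s * Gamma s = 1" by (simp add: Gamma_def rGamma_eq_zero_iff)
  then have "(\<lambda>n. z ^ Suc n * of_nat (Suc n) powr - s) sums (rGamma s * mellin (polylog_kernel z) s)"
    using sums_mult[OF mellin_polylog_kernel_sums[OF assms], of "rGamma s"] by (simp add: mult_ac) (simp add: mult.assoc[symmetric])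
  moreover have "polylog z s = rGamma s * mellin (polylog_kernel z) s"
    using polylog_eq[OF assms(1,2), of 0 s] assms(3) by (simp add: polylog_deriv_0)
  ultimately show ?thesis by simp
qed

lemma periodic_zeta_eq_polylog:
  assumes "0 < a" "a < 1"
  shows "periodic_zeta a = polylog (root_at a)"
proof (rule periodic_zeta_eqI)
  note z = norm_root_at root_at_neq_1[OF assms]
  show "polylog (root_at a) holomorphic_on UNIV"
    by (rule polylog_holomorphic[OF z])
  fix s :: complex assume s: "Re s > 1"
  have "exp (2 * of_real pi * \<i> * of_nat (Suc n) * of_real a) = root_at a ^ Suc n" for n
    unfolding root_at_def by (subst exp_of_nat_mult[symmetric]) (simp add: mult_ac)
  then show "polylog (root_at a) s = periodic_zeta_series a s"
    unfolding periodic_zeta_series_def using polylog_sums[OF z s] by (simp add: sums_iff)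
qed

subsection \<open>The values on the nonnegative real axis\<close>

text \<open>A nonnegative integrand with nonpositive integral vanishes almost everywhere; strict
  positivity would then make \<open>{0<..1}\<close> a null set, but its measure is 1.\<close>

lemma set_integral_Ioi_pos:
  fixes f :: "real \<Rightarrow> real"
  assumes "set_integrable lborel {0<..} f" "\<And>x. x > 0 \<Longrightarrow> f x > 0"
  shows "(LBINT x:{0<..}. f x) > 0"
proof (rule ccontr)
  let ?g = "\<lambda>x. indicator {0<..} x *\<^sub>R f x"
  assume "\<not> ?thesis"
  moreover have nn: "?g x \<ge> 0" for x
    using assms(2)[of x] by (auto simp: indicator_def)
  moreover from nn have "integral\<^sup>L lborel ?g \<ge> 0" by (intro integral_nonneg_AE) auto
  ultimately have "integral\<^sup>L lborel ?g = 0" unfolding set_lebesgue_integral_def by linarith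
  then have "AE x in lborel. ?g x = 0"
    using assms(1) nn by (subst (asm) integral_nonneg_eq_0_iff_AE) (auto simp: set_integrable_def)
  then have "AE x in lborel. x \<notin> {0::real<..1}"
  proof eventually_elim
    case (elim x)
    then show ?case using assms(2)[of x] by (auto simp: indicator_def split: if_splits)
  qed
  then have "{0::real<..1} \<in> null_sets lborel"
    by (subst AE_iff_null_sets) auto
  then show False by (simp add: null_sets_def)
qed

lemma polylog_kernel_cnj: "polylog_kernel (cnj z) x = cnj (polylog_kernel z x)"
  by (simp add: polylog_kernel_def)

lemma Re_polylog_kernel_root_at:
  assumes "0 < a" "a < 1" "x \<ge> 0"
  shows "Re (polylog_kernel (root_at a) x)
    = (exp x * cos (2 * pi * a) - 1) / (norm (of_real (exp x) - root_at a))\<^sup>2"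
proof -
  define z where "z = root_at a"
  have "polylog_kernel z x = z * cnj (of_real (exp x) - z) / of_real ((norm (of_real (exp x) - z))\<^sup>2)"
    unfolding polylog_kernel_def by (subst complex_div_cnj) simp
  moreover have "z * cnj z = 1" using complex_norm_square[of z] by (simp add: z_def)
  then have "z * cnj (of_real (exp x) - z) = z * of_real (exp x) - 1" by (simp add: right_diff_distrib)
  ultimately have "Re (polylog_kernel z x) = Re (z * of_real (exp x) - 1) / (norm (of_real (exp x) - z))\<^sup>2"
    by (simp only: Re_divide_of_real)
  then show ?thesis by (simp add: z_def root_at_conv_cis mult.commute)
qed

text \<open>The angle \<open>2 * pi * a\<close> lies between \<open>pi / 2\<close> and
  \<open>pi\<close>, so the cosine is nonpositive and the numerator
  \<open>exp x * cos (2 * pi * a) - 1\<close> is at most -1.\<close>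

lemma Re_polylog_kernel_root_at_neg:
  assumes "1 / 4 \<le> a" "a \<le> 1 / 2" "x \<ge> 0"
  shows "Re (polylog_kernel (root_at a) x) < 0"
proof -
  have "cos (2 * pi * a) \<le> 0"
  proof -
    have "cos (2 * pi * a) \<le> cos (pi / 2)"
      using assms pi_gt_zero by (intro cos_monotone_0_pi_le) (auto simp: field_simps)
    then show ?thesis by simp
  qed
  then have "exp x * cos (2 * pi * a) \<le> 0" by (simp add: mult_nonneg_nonpos)
  moreover have "complex_of_real (exp x) \<noteq> root_at a"
    using exp_neq_unit[OF norm_root_at root_at_neq_1] assms by simp
  ultimately show ?thesis
    using assms by (subst Re_polylog_kernel_root_at) (auto intro!: divide_neg_pos)
qed

text \<open>The leading term of the Dirichlet series is \<open>z\<close> itself. In the others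
  \<open>m powr - x\<close> with \<open>m \<ge> 2\<close> splits as
  \<open>m powr (2 - x) * m powr - 2\<close>, where the first factor is largest at
  \<open>m = 2\<close>.\<close>

lemma polylog_asymp:
  fixes x :: real
  assumes "norm z = 1" "z \<noteq> 1" "x \<ge> 2"
  shows "norm (polylog z (of_real x) - z) \<le> 2 powr (2 - x) * (\<Sum>n. 1 / (real n + 2)\<^sup>2)"
proof -
  let ?f = "\<lambda>n. z ^ Suc n * of_nat (Suc n) powr - complex_of_real x"
  have "?f sums polylog z (of_real x)" using polylog_sums[OF assms(1,2)] assms(3) by simp
  then have s: "(\<lambda>n. ?f (Suc n)) sums (polylog z (of_real x) - z)"
    by (subst sums_Suc_iff) simp
  have b: "norm (?f (Suc n)) \<le> 2 powr (2 - x) * (1 / (real n + 2)\<^sup>2)" for n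
  proof -
    have "norm (?f (Suc n)) = (real n + 2) powr - x"
      using assms(1) norm_powr_pos[of "real n + 2" "- of_real x"]
      by (simp add: norm_mult norm_power add_ac del: of_nat_Suc) (simp add: add_ac)
    also have "\<dots> = (real n + 2) powr (2 - x) * (real n + 2) powr - 2"
      by (simp flip: powr_add)
    also have "(real n + 2) powr - 2 = 1 / (real n + 2)\<^sup>2"
      by (simp add: powr_minus divide_inverse)
    also have "(real n + 2) powr (2 - x) \<le> 2 powr (2 - x)"
      using assms(3) by (intro powr_mono2') auto
    finally show ?thesis by (simp add: divide_right_mono)
  qed
  have "summable (\<lambda>n. 1 / (real (n + 2))\<^sup>2)"
    using inverse_power_summable[of 2, where 'a = real] by (subst summable_iff_shift) (simp add: inverse_eq_divide)
  then have sm: "summable (\<lambda>n. 1 / (real n + 2)\<^sup>2)" by (simp add: add.commute)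
  have "norm (polylog z (of_real x) - z) = norm (\<Sum>n. ?f (Suc n))" using s by (simp add: sums_iff)
  also have "\<dots> \<le> (\<Sum>n. 2 powr (2 - x) * (1 / (real n + 2)\<^sup>2))"
    by (rule norm_suminf_le[OF b]) (intro summable_mult sm)
  also have "\<dots> = 2 powr (2 - x) * (\<Sum>n. 1 / (real n + 2)\<^sup>2)" by (rule suminf_mult[OF sm])
  finally show ?thesis .
qed

section \<open>Integral representations of \<open>P\<close> and its values at nonnegative
  reals\<close>

context
  fixes a :: real
  assumes a: "0 < a" "a < 1"
begin

lemma reflect_bounds: "0 < 1 - a" "1 - a < 1" using a by auto

lemma P_eq: "P s a = polylog (root_at a) s + polylog (root_at (1 - a)) s"
  by (simp add: P_def periodic_zeta_eq_polylog a)

lemma P_holomorphic: "(\<lambda>s. P s a) holomorphic_on A"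
  unfolding P_eq using polylog_holomorphic[OF norm_root_at root_at_neq_1[OF a]]
    polylog_holomorphic[OF norm_root_at root_at_neq_1[OF reflect_bounds]]
  by (intro holomorphic_intros) (auto intro: holomorphic_on_subset)

lemma set_integrable_polylog_deriv:
  assumes "0 < b" "b < 1" "Re s > 0"
  shows "set_integrable lborel {0<..} (\<lambda>t. of_real t powr (s - 1) * polylog_deriv (root_at b) k t)"
proof -
  note z = norm_root_at root_at_neq_1[OF assms(1,2)]
  obtain C where "\<And>x. x > 0 \<Longrightarrow> norm (polylog_deriv (root_at b) k x) \<le> C * exp (- x)"
    using polylog_deriv_bound[OF z] by blast
  then show ?thesis by (rule mellin_integrable[OF polylog_deriv_continuous[OF z] _ assms(3)])
qed

text \<open>The two Mellin transforms share the factor \<open>rGamma (s + of_nat k)\<close> and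
  merge into one integral. The index \<open>k = 0\<close> serves positive \<open>s\<close>;
  \<open>k = 1\<close> serves \<open>s = 0\<close> and the strip to its left.\<close>

lemma polylog_deriv_sum_integral:
  assumes "Re s > - real k"
  shows "set_integrable lborel {0<..}
      (\<lambda>t. of_real t powr (s + of_nat k - 1) * (polylog_deriv (root_at a) k t + polylog_deriv (root_at (1 - a)) k t))"
    and "P s a = rGamma (s + of_nat k) * (LBINT t:{0<..}.
      of_real t powr (s + of_nat k - 1) * (polylog_deriv (root_at a) k t + polylog_deriv (root_at (1 - a)) k t))"
proof -
  have "Re (s + of_nat k) > 0" using assms by simp
  note i = set_integrable_polylog_deriv[OF a this] set_integrable_polylog_deriv[OF reflect_bounds this]
  show "set_integrable lborel {0<..}
      (\<lambda>t. of_real t powr (s + of_nat k - 1) * (polylog_deriv (root_at a) k t + polylog_deriv (root_at (1 - a)) k t))"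
    using set_integral_add(1)[OF i] by (simp add: distrib_left)
  show "P s a = rGamma (s + of_nat k) * (LBINT t:{0<..}.
      of_real t powr (s + of_nat k - 1) * (polylog_deriv (root_at a) k t + polylog_deriv (root_at (1 - a)) k t))"
    unfolding distrib_left set_integral_add(2)[OF i]
    by (simp add: P_eq polylog_eq[OF norm_root_at root_at_neq_1[OF a] assms]
       polylog_eq[OF norm_root_at root_at_neq_1[OF reflect_bounds] assms] mellin_def distrib_left)
qed

text \<open>The roots for \<open>a\<close> and \<open>1 - a\<close> are conjugate, so the kernels
  add up to twice a real part.\<close>

lemma P_of_real_pos:
  fixes x :: real
  assumes "x > 0"
  shows "set_integrable lborel {0<..} (\<lambda>t::real. t powr (x - 1) * (2 * Re (polylog_kernel (root_at a) t)))"
    and "P (of_real x) a = of_real (rGamma x * (LBINT t:{0<..}. t powr (x - 1) * (2 * Re (polylog_kernel (root_at a) t))))"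
proof -
  let ?f = "\<lambda>t::real. t powr (x - 1) * (2 * Re (polylog_kernel (root_at a) t))"
  have eq: "of_real t powr (of_real x + of_nat 0 - 1) * (polylog_deriv (root_at a) 0 t + polylog_deriv (root_at (1 - a)) 0 t)
     = complex_of_real (?f t)" if "t \<in> {0<..}" for t
    using that by (simp add: polylog_deriv_0 root_at_reflect polylog_kernel_cnj complex_add_cnj powr_of_real[symmetric])
  have i: "set_integrable lborel {0<..} (\<lambda>t. complex_of_real (?f t))"
    using polylog_deriv_sum_integral(1)[of 0 "of_real x"] assms
    by (subst set_integrable_cong[OF refl refl eq[symmetric]]) auto
  have "set_integrable lborel {0<..} (\<lambda>t. Re (complex_of_real (?f t)))"
    using integrable_Re[OF i[unfolded set_integrable_def]] unfolding set_integrable_def by simp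
  then show "set_integrable lborel {0<..} ?f" by simp
  have eq': "(LBINT t:{0<..}. of_real t powr (of_real x + of_nat 0 - 1) * (polylog_deriv (root_at a) 0 t + polylog_deriv (root_at (1 - a)) 0 t))
     = (LBINT t:{0<..}. complex_of_real (?f t))"
    by (intro set_lebesgue_integral_cong allI impI eq) auto
  have "P (of_real x) a = rGamma (of_real x) * (LBINT t:{0<..}. complex_of_real (?f t))"
    using polylog_deriv_sum_integral(2)[of 0 "of_real x"] assms unfolding eq' by simp
  also have "(LBINT t:{0<..}. complex_of_real (?f t)) = of_real (LBINT t:{0<..}. ?f t)"
    by (rule set_integral_complex_of_real)
  finally show "P (of_real x) a = of_real (rGamma x * (LBINT t:{0<..}. ?f t))"
    by (simp add: rGamma_complex_of_real)
qed

text \<open>With \<open>k = 1\<close> at \<open>s = 0\<close> the power and the Gamma factor are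
  both 1, so \<open>P 0 a\<close> is the integral of a derivative and only the boundary value at 0
  survives: \<open>w / (1 - w)\<close> plus its conjugate, for \<open>w = root_at a\<close>.\<close>

lemma P_0: "P 0 a = - 1"
proof -
  define k where "k = (\<lambda>x. polylog_kernel (root_at a) x + polylog_kernel (root_at (1 - a)) x)"
  define k' where "k' = (\<lambda>x. polylog_deriv (root_at a) 1 x + polylog_deriv (root_at (1 - a)) 1 x)"
  note z = norm_root_at root_at_neq_1[OF a]
  note z' = norm_root_at root_at_neq_1[OF reflect_bounds]
  obtain C where C: "\<And>x. x > 0 \<Longrightarrow> norm (polylog_deriv (root_at a) 0 x) \<le> C * exp (- x)"
    using polylog_deriv_bound[OF z] by blast
  obtain C' where C': "\<And>x. x > 0 \<Longrightarrow> norm (polylog_deriv (root_at (1 - a)) 0 x) \<le> C' * exp (- x)"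
    using polylog_deriv_bound[OF z'] by blast
  have D: "(k has_vector_derivative - k' x) (at x)" if "x \<ge> 0" for x
    using has_vector_derivative_add[OF polylog_deriv_has_derivative[OF z that, of 0] polylog_deriv_has_derivative[OF z' that, of 0]]
    by (simp add: k_def k'_def polylog_deriv_0)
  have "(LBINT t:{0<..}. k' t) = 0 - (- k 0)"
  proof (rule integral_Ioi_FTC)
    show "((\<lambda>x. - k x) has_vector_derivative k' x) (at x)" if "x > 0" for x
      using has_vector_derivative_minus[OF D[of x]] that by simp
    show "continuous_on {0<..} k'"
      unfolding k'_def by (intro continuous_intros polylog_deriv_continuous z z')
    show "set_integrable lborel {0<..} k'"
      using polylog_deriv_sum_integral(1)[of 1 0]
      by (rule set_integrable_cong[THEN iffD1, rotated -1]) (auto simp: k'_def)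
    have "isCont k 0" by (rule has_vector_derivative_continuous[OF D]) simp
    then show "((\<lambda>x. - k x) \<longlongrightarrow> - k 0) (at_right 0)"
      by (intro tendsto_minus) (simp add: isCont_def filterlim_at_split)
    have "((\<lambda>x::real. (C + C') * exp (- x)) \<longlongrightarrow> 0) at_top" by real_asymp
    then show "((\<lambda>x. - k x) \<longlongrightarrow> 0) at_top"
    proof (rule Lim_null_comparison[rotated])
      have "norm (k x) \<le> (C + C') * exp (- x)" if "x > 0" for x
        using norm_triangle_mono[OF C[OF that] C'[OF that]] by (simp add: k_def polylog_deriv_0 distrib_right)
      then show "\<forall>\<^sub>F x in at_top. norm (- k x) \<le> (C + C') * exp (- x)"
        by (auto intro: eventually_mono[OF eventually_gt_at_top[of 0]])
    qed
  qed
  moreover have "P 0 a = (LBINT t:{0<..}. k' t)"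
    using polylog_deriv_sum_integral(2)[of 1 0]
    by (subst set_lebesgue_integral_cong[of "{0<..}" lborel k' "\<lambda>t. of_real t powr (0 + of_nat 1 - 1) * (polylog_deriv (root_at a) 1 t + polylog_deriv (root_at (1 - a)) 1 t)"])
       (auto simp: k'_def)
  moreover have "k 0 = - 1"
  proof -
    define w where "w = root_at a"
    have w: "w \<noteq> 1" "w \<noteq> 0" using z by (auto simp: w_def)
    have "cnj w = 1 / w"
      using w norm_root_at[of a] complex_norm_square[of w] by (simp add: w_def field_simps del: norm_root_at)
    then have "k 0 = w / (1 - w) + (1 / w) / (1 - 1 / w)" by (simp add: k_def polylog_kernel_def root_at_reflect w_def)
    also have "\<dots> = - 1" using w by (simp add: divide_simps) (simp add: algebra_simps)
    finally show ?thesis .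
  qed
  ultimately show ?thesis by simp
qed

lemma P_tendsto: "((\<lambda>x::real. Re (P (of_real x) a)) \<longlongrightarrow> 2 * cos (2 * pi * a)) at_top"
proof -
  define S where "S = (\<Sum>n. 1 / (real n + 2)\<^sup>2)"
  have "((\<lambda>x::real. 2 powr (2 - x) * S) \<longlongrightarrow> 0) at_top" by real_asymp
  then have L: "((\<lambda>x. polylog (root_at b) (complex_of_real x) - root_at b) \<longlongrightarrow> 0) at_top" if "0 < b" "b < 1" for b
    by (rule Lim_null_comparison[rotated])
       (use polylog_asymp[OF norm_root_at root_at_neq_1[OF that]] in \<open>auto simp: S_def intro: eventually_mono[OF eventually_ge_at_top[of 2]]\<close>)
  have "((\<lambda>x. P (complex_of_real x) a) \<longlongrightarrow> root_at a + root_at (1 - a)) at_top"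
    unfolding P_eq using L[OF a] L[OF reflect_bounds] by (intro tendsto_add) (simp_all add: LIM_zero_iff)
  then have "((\<lambda>x. Re (P (complex_of_real x) a)) \<longlongrightarrow> Re (root_at a + root_at (1 - a))) at_top"
    by (rule tendsto_Re)
  also have "Re (root_at a + root_at (1 - a)) = 2 * cos (2 * pi * a)"
    by (simp add: root_at_reflect) (simp add: root_at_conv_cis)
  finally show ?thesis .
qed

lemma P_nonneg_real_zero:
  assumes "a < 1 / 4"
  shows "\<exists>x\<ge>0. P (complex_of_real x) a = 0"
proof -
  \<comment> \<open>The limit of \<open>P\<close> at infinity is positive because
    \<open>2 * pi * a < pi / 2\<close>.\<close>
  have "cos (2 * pi * a) > 0" using a assms by (intro cos_gt_zero) (auto simp: field_simps)
  then have "eventually (\<lambda>x. Re (P (complex_of_real x) a) > 0) at_top"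
    by (intro order_tendstoD(1)[OF P_tendsto]) simp
  from eventually_conj[OF this eventually_gt_at_top[of 0]]
  obtain b where b: "b > 0" "Re (P (complex_of_real b) a) > 0"
    by (auto simp: eventually_at_top_linorder)
  have "continuous_on {0..b} (\<lambda>x. Re (P (complex_of_real x) a))"
    by (intro continuous_intros continuous_on_compose2[OF holomorphic_on_imp_continuous_on[OF P_holomorphic[of UNIV]]]) auto
  then obtain x where x: "0 \<le> x" "x \<le> b" "Re (P (complex_of_real x) a) = 0"
    using IVT'[of "\<lambda>x. Re (P (complex_of_real x) a)" 0 0 b] b P_0 by auto
  \<comment> \<open>For positive \<open>x\<close> the value of \<open>P\<close> is real, so a
    vanishing real part is a zero; the endpoint 0 is excluded by \<open>P 0 a = - 1\<close>.\<close>
  have "x \<noteq> 0" using x(3) P_0 by auto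
  with x(1,3) show ?thesis
    using P_of_real_pos(2)[of x] by (intro exI[of _ x]) (auto simp: complex_eq_iff)
qed

text \<open>The real integrand has constant sign, so its integral cannot vanish, and neither does
  \<open>rGamma x\<close> for \<open>x > 0\<close>.\<close>

lemma P_pos_real_nonzero:
  assumes "1 / 4 \<le> a" "a \<le> 1 / 2" "x > 0"
  shows "P (complex_of_real x) a \<noteq> 0"
proof -
  have "(LBINT t:{0<..}. - (t powr (x - 1) * (2 * Re (polylog_kernel (root_at a) t)))) > 0"
  proof (rule set_integral_Ioi_pos)
    show "set_integrable lborel {0<..} (\<lambda>t. - (t powr (x - 1) * (2 * Re (polylog_kernel (root_at a) t))))"
      using P_of_real_pos(1)[OF assms(3)] by (simp add: set_integrable_def)
    fix t :: real assume "t > 0"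
    then have "t powr (x - 1) * (2 * Re (polylog_kernel (root_at a) t)) < 0"
      using Re_polylog_kernel_root_at_neg[OF assms(1,2), of t] by (intro mult_pos_neg) auto
    then show "- (t powr (x - 1) * (2 * Re (polylog_kernel (root_at a) t))) > 0" by simp
  qed
  moreover have "(LBINT t:{0<..}. - (t powr (x - 1) * (2 * Re (polylog_kernel (root_at a) t)))) =
     - (LBINT t:{0<..}. t powr (x - 1) * (2 * Re (polylog_kernel (root_at a) t)))"
    by (simp add: set_lebesgue_integral_def)
  moreover have "rGamma x \<noteq> 0" using assms(3) by (auto simp: rGamma_eq_zero_iff elim!: nonpos_Ints_cases)
  ultimately show ?thesis unfolding P_of_real_pos(2)[OF assms(3)] of_real_eq_0_iff by auto
qed

end

subsection \<open>The functional equation\<close>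

text \<open>The substitution \<open>x = w * y\<close> reduces the integral to the case
  \<open>w = 1\<close>.\<close>

lemma powr_over_quadratic_scale:
  fixes s w :: real
  assumes "-1 < s" "s < 1" "w > 0"
  shows "set_integrable lborel {0<..} (\<lambda>x. x powr (s - 1) * (2 * x / (x\<^sup>2 + w\<^sup>2)))"
    and "(LBINT x:{0<..}. x powr (s - 1) * (2 * x / (x\<^sup>2 + w\<^sup>2))) = w powr (s - 1) * (pi / cos (pi * s / 2))"
proof -
  define f where "f = (\<lambda>x. indicator {0<..} x *\<^sub>R (x powr (s - 1) * (2 * x / (x\<^sup>2 + w\<^sup>2))))"
  define g where "g = (\<lambda>x::real. indicator {0<..} x *\<^sub>R (2 * (x powr s / (1 + x\<^sup>2))))"
  have eq: "f (0 + w * x) = w powr (s - 2) * g x" for x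
  proof (cases "x > 0")
    case True
    have "1 + x\<^sup>2 > 0" by (simp add: add_pos_nonneg)
    moreover have "(w * x)\<^sup>2 + w\<^sup>2 = w\<^sup>2 * (1 + x\<^sup>2)" by (simp add: algebra_simps power2_eq_square)
    moreover have "w powr (s - 2) = w powr s / w\<^sup>2" using assms by (simp add: powr_diff)
    moreover have "(w * x) powr (s - 1) = w powr s * x powr s / (w * x)"
      using assms True by (simp add: powr_diff powr_mult)
    ultimately show ?thesis using assms True by (simp add: f_def g_def divide_simps)
  next
    case False
    then show ?thesis using assms by (simp add: f_def g_def zero_less_mult_iff)
  qed
  have "integrable lborel g"
    using set_integrable_powr_over_quadratic[OF assms(1,2)] by (simp add: g_def set_integrable_def)
  then have "integrable lborel (\<lambda>x. f (0 + w * x))" unfolding eq by simp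
  then have "integrable lborel f" using lborel_integrable_real_affine_iff[of w f 0] assms(3) by simp
  then show "set_integrable lborel {0<..} (\<lambda>x. x powr (s - 1) * (2 * x / (x\<^sup>2 + w\<^sup>2)))"
    by (simp add: f_def set_integrable_def)
  have "integral\<^sup>L lborel f = w * (LBINT x. f (0 + w * x))"
    using lborel_integral_real_affine[of w f 0] assms(3) by simp
  also have "(LBINT x. f (0 + w * x)) = w powr (s - 2) * integral\<^sup>L lborel g"
    unfolding eq by (rule integral_mult_right_zero)
  also have "integral\<^sup>L lborel g = pi / cos (pi * s / 2)"
    using integral_powr_over_quadratic[OF assms(1,2)] unfolding g_def set_lebesgue_integral_def .
  also have "w * (w powr (s - 2) * (pi / cos (pi * s / 2))) = w powr (s - 1) * (pi / cos (pi * s / 2))"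
    using assms(3) by (simp add: powr_diff power2_eq_square)
  finally show "(LBINT x:{0<..}. x powr (s - 1) * (2 * x / (x\<^sup>2 + w\<^sup>2))) = w powr (s - 1) * (pi / cos (pi * s / 2))"
    by (simp add: f_def set_lebesgue_integral_def)
qed

section \<open>Series of powers of the frequencies \<open>2 * pi * (n + b)\<close>\<close>

definition freq :: "real \<Rightarrow> nat \<Rightarrow> real" where
  "freq b n = 2 * pi * (real n + b)"

lemma freq_pos: "b > 0 \<Longrightarrow> freq b n > 0"
  by (simp add: freq_def add_nonneg_pos)

lemma freq_ge: "b > 0 \<Longrightarrow> freq b n \<ge> real n"
proof -
  assume "b > 0"
  then have "1 * real n \<le> 2 * pi * (real n + b)" using pi_gt3 by (intro mult_mono) auto
  then show ?thesis by (simp add: freq_def)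
qed

lemma summable_freq_powr:
  assumes "b > 0" "c < -1"
  shows "summable (\<lambda>n. freq b n powr c)"
proof (rule summable_comparison_test')
  show "summable (\<lambda>n. real n powr c)" using assms(2) by (simp add: summable_real_powr_iff)
  show "norm (freq b n powr c) \<le> real n powr c" if "n \<ge> 1" for n
    using freq_ge[OF assms(1), of n] that assms(2) by (auto intro!: powr_mono2')
qed

lemma norm_freq_powr:
  assumes "b > 0"
  shows "norm (complex_of_real (freq b n) powr s) = freq b n powr Re s"
  using freq_pos[OF assms] by (rule norm_powr_pos)

text \<open>This is \<open>(2 \<pi>)\<^sup>s\<^sup>-\<^sup>1 \<zeta>(1 - s, b)\<close> in terms of the Hurwitz zeta function, for \<open>Re s < 0\<close>.\<close>
definition hurwitz_series :: "real \<Rightarrow> complex \<Rightarrow> complex" where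
  "hurwitz_series b s = (\<Sum>n. of_real (freq b n) powr (s - 1))"

lemma hurwitz_series_holomorphic:
  assumes "b > 0"
  shows "hurwitz_series b holomorphic_on {s. Re s < 0}"
proof (rule holomorphic_uniform_sequence)
  show "open {s. Re s < 0}" by (rule open_halfspace_Re_lt)
  show "(\<lambda>s. \<Sum>n<N. of_real (freq b n) powr (s - 1)) holomorphic_on {s. Re s < 0}" for N
    by (intro holomorphic_intros)
  fix s0 :: complex assume s0: "s0 \<in> {s. Re s < 0}"
  define d where "d = - Re s0 / 2"
  have Re_bd: "Re s \<le> Re s0 / 2" "Re s \<ge> 3 / 2 * Re s0" if "s \<in> cball s0 d" for s
    using that abs_Re_le_cmod[of "s - s0"] by (auto simp: dist_norm d_def norm_minus_commute)
  have "uniform_limit (cball s0 d) (\<lambda>N s. \<Sum>n<N. of_real (freq b n) powr (s - 1)) (\<lambda>s. \<Sum>n. of_real (freq b n) powr (s - 1)) sequentially"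
  proof (rule Weierstrass_m_test)
    \<comment> \<open>Small frequencies may lie below 1, where the smaller exponent gives the larger
      power; the majorant therefore adds the powers with both extreme exponents.\<close>
    show "summable (\<lambda>n. freq b n powr (Re s0 / 2 - 1) + freq b n powr (3 / 2 * Re s0 - 1))"
      using s0 assms by (intro summable_add summable_freq_powr) auto
    fix n s assume s: "s \<in> cball s0 d"
    have "freq b n powr (Re s - 1) \<le> freq b n powr (Re s0 / 2 - 1) + freq b n powr (3 / 2 * Re s0 - 1)"
    proof (cases "freq b n \<le> 1")
      case True
      then have "freq b n powr (Re s - 1) \<le> freq b n powr (3 / 2 * Re s0 - 1)"
        using Re_bd[OF s] freq_pos[OF assms, of n] by (intro powr_mono') auto
      then show ?thesis by (simp add: add_increasing)
    next
      case False
      then have "freq b n powr (Re s - 1) \<le> freq b n powr (Re s0 / 2 - 1)"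
        using Re_bd[OF s] by (intro powr_mono) auto
      then show ?thesis by (simp add: add_increasing2)
    qed
    then show "norm (complex_of_real (freq b n) powr (s - 1)) \<le> freq b n powr (Re s0 / 2 - 1) + freq b n powr (3 / 2 * Re s0 - 1)"
      by (simp add: norm_freq_powr[OF assms])
  qed
  then have "uniform_limit (cball s0 d) (\<lambda>N s. \<Sum>n<N. of_real (freq b n) powr (s - 1)) (hurwitz_series b) sequentially"
    by (simp add: hurwitz_series_def[abs_def])
  moreover have "cball s0 d \<subseteq> {s. Re s < 0}" using Re_bd(1) s0 by force
  moreover have "d > 0" using s0 by (simp add: d_def)
  ultimately show "\<exists>d>0. cball s0 d \<subseteq> {s. Re s < 0} \<and> uniform_limit (cball s0 d) (\<lambda>N s. \<Sum>n<N. of_real (freq b n) powr (s - 1)) (hurwitz_series b) sequentially"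
    by blast
qed

lemma hurwitz_series_of_real:
  assumes "b > 0" "x < 0"
  shows "hurwitz_series b (of_real x) = of_real (\<Sum>n. freq b n powr (x - 1))" and "(\<Sum>n. freq b n powr (x - 1)) > 0"
proof -
  have sm: "summable (\<lambda>n. freq b n powr (x - 1))" using assms by (intro summable_freq_powr) auto
  have "of_real (freq b n) powr (of_real x - 1) = complex_of_real (freq b n powr (x - 1))" for n
    using freq_pos[OF assms(1), of n] by (simp add: powr_of_real[symmetric])
  then show "hurwitz_series b (of_real x) = of_real (\<Sum>n. freq b n powr (x - 1))"
    by (simp add: hurwitz_series_def suminf_of_real[OF sm])
  show "(\<Sum>n. freq b n powr (x - 1)) > 0"
    using freq_pos[OF assms(1)] by (intro suminf_pos[OF sm]) (simp add: less_imp_neq[symmetric])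
qed

lemma cos_half_pi_eq_0_iff: "cos (complex_of_real pi * (- of_nat n) / 2) = 0 \<longleftrightarrow> odd n"
proof -
  have "cos (complex_of_real pi * (- of_nat n) / 2) = of_real (cos (real n * (pi / 2)))"
    by (simp add: mult.commute flip: cos_of_real)
  also have "\<dots> = 0 \<longleftrightarrow> (\<exists>i. odd i \<and> real n = of_int i)"
    by (simp add: cos_zero_iff_int)
  also have "\<dots> \<longleftrightarrow> odd n"
    by (metis even_of_nat of_int_eq_iff of_int_of_nat_eq)
  finally show ?thesis .
qed

section \<open>The functional equation, first on the real interval from -1 to 0, then on
  \<open>Re s < 0\<close>\<close>

context
  fixes a :: real
  assumes a: "0 < a" "a < 1"
begin

text \<open>The added 1 cancels the limit -1 of the kernels at 0, so the function is
  \<open>O(x)\<close> there while tending to 1 at infinity. This places its Mellin transform on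
  \<open>-1 < Re s < 0\<close>.\<close>

definition kernel_sum :: "real \<Rightarrow> complex" where
  "kernel_sum x = 1 + polylog_kernel (root_at a) x + polylog_kernel (root_at (1 - a)) x"

definition pfd_term :: "nat \<Rightarrow> real \<Rightarrow> real" where
  "pfd_term n x = 2 * x / (x\<^sup>2 + (freq a n)\<^sup>2) + 2 * x / (x\<^sup>2 + (freq (1 - a) n)\<^sup>2)"

lemma pfd_sums: "x > 0 \<Longrightarrow> (\<lambda>n. complex_of_real (pfd_term n x)) sums kernel_sum x"
  using polylog_kernel_partial_fractions[OF _ a, of x]
  by (simp add: pfd_term_def kernel_sum_def freq_def)

lemma pfd_term_nonneg: "x > 0 \<Longrightarrow> pfd_term n x \<ge> 0"
  by (simp add: pfd_term_def)

lemma pfd_summable: "x > 0 \<Longrightarrow> summable (\<lambda>n. pfd_term n x)"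
  using pfd_sums[of x] by (auto simp: sums_iff summable_complex_iff)

text \<open>Dropping \<open>x\<^sup>2\<close> from each denominator bounds the fractions by
  \<open>2 * x / w\<^sup>2\<close>, and the reciprocal squares of the frequencies are
  summable.\<close>

lemma kernel_sum_bound:
  obtains B where "\<And>x. x > 0 \<Longrightarrow> norm (kernel_sum x) \<le> B * x"
proof -
  define c where "c = (\<lambda>n. 2 * (freq a n powr - 2 + freq (1 - a) n powr - 2))"
  have c: "summable c"
    unfolding c_def using a by (intro summable_mult summable_add summable_freq_powr) auto
  have "norm (kernel_sum x) \<le> suminf c * x" if "x > 0" for x
  proof -
    have t: "2 * x / (x\<^sup>2 + (freq b n)\<^sup>2) \<le> 2 * freq b n powr - 2 * x" if "b > 0" for b n
    proof -
      have "2 * x / (x\<^sup>2 + (freq b n)\<^sup>2) \<le> 2 * x / (freq b n)\<^sup>2"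
        using freq_pos[OF that, of n] \<open>x > 0\<close> by (intro divide_left_mono) (auto intro!: mult_pos_pos add_pos_pos)
      then show ?thesis using freq_pos[OF that, of n] by (simp add: powr_minus divide_inverse mult_ac)
    qed
    have le: "norm (complex_of_real (pfd_term n x)) \<le> c n * x" for n
      using t[of a n] t[of "1 - a" n] a pfd_term_nonneg[OF that, of n]
      unfolding norm_of_real c_def by (simp add: pfd_term_def algebra_simps)
    have "norm (kernel_sum x) = norm (\<Sum>n. complex_of_real (pfd_term n x))"
      using pfd_sums[OF that] by (simp add: sums_iff)
    also have "\<dots> \<le> (\<Sum>n. c n * x)"
      by (rule norm_suminf_le[OF le]) (intro summable_mult2 c)
    also have "\<dots> = suminf c * x" by (rule suminf_mult2[OF c, symmetric])
    finally show ?thesis .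
  qed
  then show ?thesis by (rule that)
qed

definition hurwitz_sum :: "complex \<Rightarrow> complex" where
  "hurwitz_sum s = hurwitz_series a s + hurwitz_series (1 - a) s"

text \<open>Integration is termwise: near 0 each integrand behaves like \<open>x powr s\<close>,
  integrable for \<open>-1 < s\<close>, while \<open>s < 0\<close> makes
  \<open>freq b n powr (s - 1)\<close> summable. The terms are nonnegative, so their integrals are
  also their L1 norms.\<close>

lemma kernel_sum_mellin:
  fixes s :: real
  assumes "-1 < s" "s < 0"
  shows "set_integrable lborel {0<..} (\<lambda>x. of_real x powr (of_real s - 1) * kernel_sum x)"
    and "(LBINT x:{0<..}. of_real x powr (of_real s - 1) * kernel_sum x)
       = of_real (pi / cos (pi * s / 2)) * hurwitz_sum (of_real s)"
proof -
  define f where "f = (\<lambda>n x. complex_of_real (indicator {0<..} x *\<^sub>R (x powr (s - 1) * pfd_term n x)))"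
  define C where "C = pi / cos (pi * s / 2)"
  have a': "0 < 1 - a" using a by simp
  have s: "-1 < s" "s < 1" using assms by auto
  note q = powr_over_quadratic_scale[OF s freq_pos[OF a(1)]]
  note q' = powr_over_quadratic_scale[OF s freq_pos[OF a']]
  have int0: "set_integrable lborel {0<..} (\<lambda>x. x powr (s - 1) * pfd_term n x)"
    and val0: "(LBINT x:{0<..}. x powr (s - 1) * pfd_term n x) = C * (freq a n powr (s - 1) + freq (1 - a) n powr (s - 1))" for n
    using set_integral_add[OF q(1)[of n] q'(1)[of n]] q(2)[of n] q'(2)[of n]
    by (simp_all add: pfd_term_def C_def distrib_left mult.commute)
  have nf: "norm (f n x) = indicator {0<..} x *\<^sub>R (x powr (s - 1) * pfd_term n x)" for n x
    using pfd_term_nonneg[of x n] by (auto simp: f_def norm_mult indicator_def)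
  have int: "integrable lborel (f n)" for n
    unfolding f_def by (rule integrable_of_real[OF int0[of n, unfolded set_integrable_def]])
  have ifn: "(LBINT x. norm (f n x)) = C * (freq a n powr (s - 1) + freq (1 - a) n powr (s - 1))" for n
    using val0[of n] unfolding nf set_lebesgue_integral_def .
  have ifn': "integral\<^sup>L lborel (f n) = of_real (C * (freq a n powr (s - 1) + freq (1 - a) n powr (s - 1)))" for n
    unfolding val0[of n, symmetric] f_def set_lebesgue_integral_def
    by (rule integral_of_real[OF int0[of n, unfolded set_integrable_def]])
  have sm: "summable (\<lambda>n. freq a n powr (s - 1))" "summable (\<lambda>n. freq (1 - a) n powr (s - 1))"
    using a assms by (auto intro!: summable_freq_powr)
  have fs: "(\<lambda>n. f n x) sums (indicator {0<..} x *\<^sub>R (of_real x powr (of_real s - 1) * kernel_sum x))" for x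
  proof (cases "x > 0")
    case True
    from sums_mult[OF pfd_sums[OF this], of "of_real x powr (of_real s - 1)"] True show ?thesis
      by (simp add: f_def powr_of_real[symmetric])
  qed (simp add: f_def)
  have AE: "AE x in lborel. summable (\<lambda>n. norm (f n x))"
  proof (rule AE_I2)
    fix x :: real
    show "summable (\<lambda>n. norm (f n x))"
      unfolding nf by (cases "x > 0") (auto intro!: summable_mult pfd_summable)
  qed
  have sm': "summable (\<lambda>n. LBINT x. norm (f n x))"
    unfolding ifn by (intro summable_mult summable_add sm)
  have lim: "(\<Sum>n. f n x) = indicator {0<..} x *\<^sub>R (of_real x powr (of_real s - 1) * kernel_sum x)" for x
    using fs[of x] by (simp add: sums_iff)
  show "set_integrable lborel {0<..} (\<lambda>x. of_real x powr (of_real s - 1) * kernel_sum x)"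
    unfolding set_integrable_def lim[symmetric] by (rule integrable_suminf[OF int AE sm'])
  have "(LBINT x:{0<..}. of_real x powr (of_real s - 1) * kernel_sum x) = (\<Sum>n. integral\<^sup>L lborel (f n))"
    unfolding set_lebesgue_integral_def lim[symmetric] by (rule integral_suminf[OF int AE sm'])
  also have "\<dots> = of_real (\<Sum>n. C * (freq a n powr (s - 1) + freq (1 - a) n powr (s - 1)))"
    unfolding ifn' by (intro suminf_of_real[symmetric] summable_mult summable_add sm)
  also have "(\<Sum>n. C * (freq a n powr (s - 1) + freq (1 - a) n powr (s - 1)))
     = C * ((\<Sum>n. freq a n powr (s - 1)) + (\<Sum>n. freq (1 - a) n powr (s - 1)))"
    by (simp add: suminf_mult suminf_add summable_add sm)
  also have "complex_of_real \<dots> = of_real C * hurwitz_sum (of_real s)"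
    by (simp add: hurwitz_sum_def hurwitz_series_of_real(1)[OF a(1) assms(2)] hurwitz_series_of_real(1)[OF a' assms(2)])
  finally show "(LBINT x:{0<..}. of_real x powr (of_real s - 1) * kernel_sum x)
       = of_real (pi / cos (pi * s / 2)) * hurwitz_sum (of_real s)"
    by (simp add: C_def)
qed

text \<open>The representation of \<open>P\<close> with \<open>k = 1\<close> contains the derivative
  of the kernels, which up to sign is also that of \<open>kernel_sum\<close>. Integrating by parts
  backwards replaces it by \<open>kernel_sum\<close>, whose Mellin transform is known.\<close>

lemma P_functional_equation_strip:
  fixes s :: real
  assumes "-1 < s" "s < 0"
  shows "P (of_real s) a * cos (of_real pi * of_real s / 2) = of_real pi * rGamma (of_real s) * hurwitz_sum (of_real s)"
proof -
  define S where "S = complex_of_real s"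
  define k' where "k' = (\<lambda>x. polylog_deriv (root_at a) 1 x + polylog_deriv (root_at (1 - a)) 1 x)"
  have a': "0 < 1 - a" "1 - a < 1" using a by auto
  note z = norm_root_at root_at_neq_1[OF a]
  note z' = norm_root_at root_at_neq_1[OF a']
  obtain C where C: "\<And>x. x > 0 \<Longrightarrow> norm (polylog_deriv (root_at a) 0 x) \<le> C * exp (- x)"
    using polylog_deriv_bound[OF z] by blast
  obtain C' where C': "\<And>x. x > 0 \<Longrightarrow> norm (polylog_deriv (root_at (1 - a)) 0 x) \<le> C' * exp (- x)"
    using polylog_deriv_bound[OF z'] by blast
  obtain B where B: "\<And>x. x > 0 \<Longrightarrow> norm (kernel_sum x) \<le> B * x" by (rule kernel_sum_bound) blast
  have D: "(kernel_sum has_vector_derivative - k' x) (at x)" if "x > 0" for x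
  proof -
    have "x \<ge> 0" using that by simp
    from has_vector_derivative_add[OF has_vector_derivative_add[OF has_vector_derivative_const[of 1]
          polylog_deriv_has_derivative[OF z this, of 0]] polylog_deriv_has_derivative[OF z' this, of 0]]
    show ?thesis by (simp add: kernel_sum_def[abs_def] k'_def polylog_deriv_0)
  qed
  have cont: "continuous_on {0<..} kernel_sum"
    by (intro continuous_at_imp_continuous_on ballI has_vector_derivative_continuous[OF D]) auto
  have i1: "set_integrable lborel {0<..} (\<lambda>x. S * (of_real x powr (S - 1) * kernel_sum x))"
    unfolding S_def by (intro set_integrable_mult_right kernel_sum_mellin(1) assms)
  have i2: "set_integrable lborel {0<..} (\<lambda>x. of_real x powr S * k' x)"
    using polylog_deriv_sum_integral(1)[OF a, of 1 S] assms by (simp add: S_def k'_def)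
  \<comment> \<open>Both boundary values of \<open>x powr S * kernel_sum x\<close> are 0: at 0 by
    the linear bound and \<open>-1 < s\<close>, at infinity by boundedness and
    \<open>s < 0\<close>.\<close>
  have "(LBINT x:{0<..}. S * (of_real x powr (S - 1) * kernel_sum x) - of_real x powr S * k' x) = 0 - 0"
  proof (rule integral_Ioi_FTC)
    show "((\<lambda>x. of_real x powr S * kernel_sum x) has_vector_derivative
        S * (of_real x powr (S - 1) * kernel_sum x) - of_real x powr S * k' x) (at x)" if "x > 0" for x
    proof -
      have "((\<lambda>x. of_real x powr S) has_vector_derivative S * of_real x powr (S - 1)) (at x)"
        using that by (auto intro!: derivative_eq_intros has_vector_derivative_real_field simp: powr_diff complex_nonpos_Reals_iff)
      from has_vector_derivative_mult[OF this D[OF that]] show ?thesis by (simp add: algebra_simps)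
    qed
    show "continuous_on {0<..} (\<lambda>x. S * (of_real x powr (S - 1) * kernel_sum x) - of_real x powr S * k' x)"
      unfolding k'_def by (intro continuous_intros cont polylog_deriv_continuous z z')
    show "set_integrable lborel {0<..} (\<lambda>x. S * (of_real x powr (S - 1) * kernel_sum x) - of_real x powr S * k' x)"
      by (intro set_integral_diff i1 i2)
    have n: "norm (of_real x powr S * kernel_sum x) = x powr s * norm (kernel_sum x)" if "x > 0" for x
      using that by (simp add: norm_mult norm_powr_pos S_def)
    have "((\<lambda>x::real. x powr s * (B * x)) \<longlongrightarrow> 0) (at_right 0)"
      using assms(1) by real_asymp
    then show "((\<lambda>x. of_real x powr S * kernel_sum x) \<longlongrightarrow> 0) (at_right 0)"
      by (rule Lim_null_comparison[rotated])
         (auto simp: eventually_at_right_field n intro!: exI[of _ 1] mult_left_mono B)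
    have "((\<lambda>x::real. x powr s * (1 + (C + C'))) \<longlongrightarrow> 0) at_top"
      using assms(2) by real_asymp
    then show "((\<lambda>x. of_real x powr S * kernel_sum x) \<longlongrightarrow> 0) at_top"
    proof (rule Lim_null_comparison[rotated])
      have "norm (kernel_sum x) \<le> 1 + (C + C')" if "x > 0" for x
      proof -
        have "C \<ge> 0" "C' \<ge> 0"
          using order_trans[OF norm_ge_zero C[of 1]] order_trans[OF norm_ge_zero C'[of 1]]
          by (auto simp: zero_le_mult_iff)
        then have "C * exp (- x) \<le> C" "C' * exp (- x) \<le> C'"
          using that by (auto intro!: mult_left_le)
        moreover have "norm (kernel_sum x) \<le> 1 + (C * exp (- x) + C' * exp (- x))"
          using norm_triangle_mono[OF norm_triangle_mono[OF _ C[OF that]] C'[OF that], of 1 1]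
          by (simp add: kernel_sum_def polylog_deriv_0)
        ultimately show ?thesis by linarith
      qed
      then have "norm (of_real x powr S * kernel_sum x) \<le> x powr s * (1 + (C + C'))" if "x > 0" for x
        using that by (simp add: n mult_left_mono)
      then show "\<forall>\<^sub>F x in at_top. norm (of_real x powr S * kernel_sum x) \<le> x powr s * (1 + (C + C'))"
        by (auto intro: eventually_mono[OF eventually_gt_at_top[of 0]])
    qed
  qed
  then have "(LBINT x:{0<..}. of_real x powr S * k' x) = S * (LBINT x:{0<..}. of_real x powr (S - 1) * kernel_sum x)"
    unfolding set_integral_diff(2)[OF i1 i2] by simp
  moreover have "P S a = rGamma (S + 1) * (LBINT x:{0<..}. of_real x powr S * k' x)"
    using polylog_deriv_sum_integral(2)[OF a, of 1 S] assms by (simp add: S_def k'_def)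
  ultimately have "P S a = S * rGamma (S + 1) * (of_real (pi / cos (pi * s / 2)) * hurwitz_sum S)"
    using kernel_sum_mellin(2)[OF assms] by (simp add: S_def)
  also have "S * rGamma (S + 1) = rGamma S" by (rule rGamma_plus1)
  finally have "P S a = rGamma S * (of_real (pi / cos (pi * s / 2)) * hurwitz_sum S)" .
  moreover have "cos (of_real pi * S / 2) = of_real (cos (pi * s / 2))"
    by (simp add: S_def flip: cos_of_real)
  \<comment> \<open>Positivity of the cosine on the interval allows multiplying it over to the other
    side.\<close>
  moreover have "cos (pi * s / 2) > 0"
  proof -
    have "- (pi / 2) < pi * s / 2" "pi * s / 2 < pi / 2" 
      using mult_strict_left_mono[OF assms(1) pi_gt_zero] mult_pos_neg[OF pi_gt_zero assms(2)] pi_gt_zero by linarith+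
    then show ?thesis by (rule cos_gt_zero_pi)
  qed
  ultimately show ?thesis unfolding S_def[symmetric] by simp
qed

lemma hurwitz_sum_holomorphic: "hurwitz_sum holomorphic_on {s. Re s < 0}"
  unfolding hurwitz_sum_def[abs_def] using a by (intro holomorphic_intros hurwitz_series_holomorphic) auto

text \<open>In this product form both sides are holomorphic on the whole left half-plane, including
  the zeros of the cosine, and they agree on a real segment; the identity theorem does the
  rest.\<close>

theorem P_functional_equation:
  assumes "Re s < 0"
  shows "P s a * cos (of_real pi * s / 2) = of_real pi * rGamma s * hurwitz_sum s"
proof -
  define H where "H = (\<lambda>s. P s a * cos (of_real pi * s / 2) - of_real pi * rGamma s * hurwitz_sum s)"
  have "H s = 0"
  proof (rule analytic_continuation[where f = H and S = "{s. Re s < 0}" and U = "complex_of_real ` {-1<..<0}" and \<xi> = "- 1 / 2"])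
    show "H holomorphic_on {s. Re s < 0}"
      unfolding H_def by (intro holomorphic_intros P_holomorphic[OF a] hurwitz_sum_holomorphic) auto
    show "open {s. Re s < 0}" by (rule open_halfspace_Re_lt)
    show "connected {s. Re s < 0}" by (intro convex_connected convex_halfspace_Re_lt)
    show "(- 1 / 2 :: complex) islimpt complex_of_real ` {-1<..<0}"
      unfolding islimpt_approachable
    proof (intro allI impI)
      fix e :: real assume e: "e > 0"
      \<comment> \<open>A quarter of \<open>min e 1\<close> is below both \<open>e\<close> and
        \<open>1 / 2\<close>, so the shifted point stays inside the segment.\<close>
      define t where "t = min e 1 / 4"
      have t: "0 < t" "t < 1 / 2" "t < e" using e by (auto simp: t_def min_def)
      show "\<exists>x'\<in>complex_of_real ` {-1<..<0}. x' \<noteq> - 1 / 2 \<and> dist x' (- 1 / 2) < e"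
      proof (rule bexI[of _ "complex_of_real (- 1 / 2 + t)"])
        have "dist (complex_of_real (- 1 / 2 + t)) (- 1 / 2) = t" using t by (simp add: dist_norm)
        then show "complex_of_real (- 1 / 2 + t) \<noteq> - 1 / 2 \<and> dist (complex_of_real (- 1 / 2 + t)) (- 1 / 2) < e"
          using t by auto
        show "complex_of_real (- 1 / 2 + t) \<in> complex_of_real ` {-1<..<0}" using t by (intro imageI) auto
      qed
    qed
    show "H x = 0" if "x \<in> complex_of_real ` {-1<..<0}" for x
      using that P_functional_equation_strip by (auto simp: H_def)
  qed (use assms in auto)
  then show ?thesis by (simp add: H_def)
qed

text \<open>At a real argument both series consist of positive powers.\<close>

lemma hurwitz_sum_nonzero:
  assumes "x < 0"
  shows "hurwitz_sum (of_real x) \<noteq> 0"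
proof -
  have a': "0 < 1 - a" using a by simp
  have "hurwitz_sum (of_real x) = of_real ((\<Sum>n. freq a n powr (x - 1)) + (\<Sum>n. freq (1 - a) n powr (x - 1)))"
    by (simp add: hurwitz_sum_def hurwitz_series_of_real(1) a assms)
  then show ?thesis
    using hurwitz_series_of_real(2)[OF a(1) assms] hurwitz_series_of_real(2)[OF a' assms]
    unfolding \<open>_ = _\<close> of_real_eq_0_iff by linarith
qed

text \<open>Differentiating the functional equation at \<open>- n\<close>, where
  \<open>rGamma\<close> has a simple zero, leaves a nonzero right-hand side. For odd
  \<open>n\<close> the cosine is 0, so \<open>P\<close> cannot vanish; for even \<open>n\<close> a
  zero of \<open>P\<close> must have nonzero derivative.\<close>

lemma P_deriv_neg_int:
  assumes "n \<ge> 1"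
  shows "deriv (\<lambda>s. P s a) (- of_nat n) * cos (of_real pi * (- of_nat n) / 2) \<noteq> P (- of_nat n) a * (of_real pi / 2 * sin (of_real pi * (- of_nat n) / 2))"
proof -
  define s0 :: complex where "s0 = - of_nat n"
  have s0: "Re s0 < 0" "s0 = of_real (- real n)" using assms by (auto simp: s0_def)
  have "(\<lambda>s. P s a) holomorphic_on UNIV" by (rule P_holomorphic[OF a])
  then have DP: "((\<lambda>s. P s a) has_field_derivative deriv (\<lambda>s. P s a) s0) (at s0)"
    by (rule holomorphic_derivI) auto
  have DW: "(hurwitz_sum has_field_derivative deriv hurwitz_sum s0) (at s0)"
    using s0 by (intro holomorphic_derivI[OF hurwitz_sum_holomorphic]) (auto simp: open_halfspace_Re_lt)
  have DG: "(rGamma has_field_derivative (-1) ^ n * fact n) (at s0)"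
    unfolding s0_def by (rule has_field_derivative_rGamma_nonpos_int)
  have "rGamma s0 = 0" by (simp add: s0_def rGamma_eq_zero_iff)
  have 1: "((\<lambda>s. P s a * cos (of_real pi * s / 2)) has_field_derivative
      deriv (\<lambda>s. P s a) s0 * cos (of_real pi * s0 / 2) - P s0 a * (of_real pi / 2 * sin (of_real pi * s0 / 2))) (at s0)"
    by (rule derivative_eq_intros DP refl | simp)+
  have 2: "((\<lambda>s. of_real pi * rGamma s * hurwitz_sum s) has_field_derivative
      of_real pi * ((-1) ^ n * fact n) * hurwitz_sum s0) (at s0)"
    using DERIV_mult[OF DERIV_cmult[OF DG, of "of_real pi"] DW] \<open>rGamma s0 = 0\<close> by simp
  have "((\<lambda>s. of_real pi * rGamma s * hurwitz_sum s) has_field_derivative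
      deriv (\<lambda>s. P s a) s0 * cos (of_real pi * s0 / 2) - P s0 a * (of_real pi / 2 * sin (of_real pi * s0 / 2))) (at s0)"
    by (rule has_field_derivative_transform_within_open[OF 1 open_halfspace_Re_lt[of 0]])
       (use s0 P_functional_equation in auto)
  from DERIV_unique[OF this 2]
  have "deriv (\<lambda>s. P s a) s0 * cos (of_real pi * s0 / 2) - P s0 a * (of_real pi / 2 * sin (of_real pi * s0 / 2))
      = of_real pi * ((-1) ^ n * fact n) * hurwitz_sum s0" .
  also have "\<dots> \<noteq> 0" using hurwitz_sum_nonzero[of "- real n"] assms s0(2) by auto
  finally show ?thesis by (simp only: s0_def right_minus_eq not_False_eq_True)
qed

end

section \<open>Zeros on the negative real axis and the equivalence\<close>

lemma P_neg_real_zero_iff: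
  assumes "0 < a" "a < 1" "x < 0"
  shows "P (complex_of_real x) a = 0 \<longleftrightarrow> (\<exists>k::nat. k \<ge> 1 \<and> x = - 2 * real k)"
proof
  assume "\<exists>k::nat. k \<ge> 1 \<and> x = - 2 * real k"
  then obtain k :: nat where k: "k \<ge> 1" "x = - real (2 * k)" by auto
  then have x: "complex_of_real x = - of_nat (2 * k)" by simp
  \<comment> \<open>At a negative even integer the right-hand side of the functional equation
    vanishes while the cosine does not.\<close>
  have "rGamma (complex_of_real x) = 0"
    unfolding x by (simp add: rGamma_eq_zero_iff del: of_nat_mult)
  moreover have "cos (of_real pi * complex_of_real x / 2) \<noteq> 0"
    unfolding x by (simp only: cos_half_pi_eq_0_iff) simp
  ultimately show "P (complex_of_real x) a = 0"
    using P_functional_equation[OF assms(1,2), of "of_real x"] assms(3) by simp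
next
  assume P: "P (complex_of_real x) a = 0"
  have "of_real pi * rGamma (complex_of_real x) * hurwitz_sum a (of_real x) = 0"
    using P_functional_equation[of a "of_real x"] assms P by simp
  then have "rGamma (complex_of_real x) = 0" using hurwitz_sum_nonzero[of a x] assms by simp
  then have "complex_of_real x \<in> \<int>\<^sub>\<le>\<^sub>0" by (simp add: rGamma_eq_zero_iff)
  then obtain n where n: "complex_of_real x = - of_nat n" by (auto elim!: nonpos_Ints_cases')
  then have xn: "x = - real n" by (metis of_real_eq_iff of_real_minus of_real_of_nat_eq)
  have n1: "n \<ge> 1" using assms(3) xn by simp
  \<comment> \<open>For odd \<open>n\<close> the cosine and \<open>P\<close> would both vanish, and
    the two products distinguished by \<open>P_deriv_neg_int\<close> would both be 0.\<close>
  have "even n"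
    using P_deriv_neg_int[OF assms(1,2) n1] P cos_half_pi_eq_0_iff[of n] by (auto simp: n)
  then obtain k where "n = 2 * k" by (auto elim: evenE)
  then show "\<exists>k::nat. k \<ge> 1 \<and> x = - 2 * real k" using xn n1 by (intro exI[of _ k]) auto
qed

text \<open>Since \<open>P\<close> vanishes at the point, \<open>P_deriv_neg_int\<close> reduces to
  a nonzero derivative, which means order one.\<close>

lemma zorder_P_neg_even:
  assumes "0 < a" "a < 1" "k \<ge> 1"
  shows "zorder (\<lambda>s. P s a) (- 2 * of_nat k) = 1"
proof -
  define s0 :: complex where "s0 = - of_nat (2 * k)"
  have "complex_of_real (- 2 * real k) = s0" by (simp add: s0_def)
  then have P0: "P s0 a = 0" using P_neg_real_zero_iff[OF assms(1,2), of "- 2 * real k"] assms(3) by auto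
  have "deriv (\<lambda>s. P s a) s0 \<noteq> 0"
    using P_deriv_neg_int[OF assms(1,2), of "2 * k"] assms(3) P0 unfolding s0_def by auto
  moreover have "(\<lambda>s. P s a) analytic_on {s0}"
    by (rule holomorphic_on_imp_analytic_at[OF P_holomorphic[OF assms(1,2)] open_UNIV]) simp
  ultimately have "zorder (\<lambda>s. P s a) s0 = 1"
    using P0 by (intro zorder_zero_eqI') auto
  then show ?thesis by (simp add: s0_def)
qed

theorem theorem1p4:
  fixes a :: real
  assumes "0 < a" and "a \<le> 1/2"
  shows "({x::real. P (of_real x) a = 0} = {- 2 * real k |k. k \<ge> 1} \<and>
          (\<forall>k::nat. k \<ge> 1 \<longrightarrow> zorder (\<lambda>s. P s a) (- 2 * of_nat k) = 1))
         \<longleftrightarrow> (1/4 \<le> a \<and> a \<le> 1/2)"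
proof
  assume *: "{x::real. P (of_real x) a = 0} = {- 2 * real k |k. k \<ge> 1} \<and>
          (\<forall>k::nat. k \<ge> 1 \<longrightarrow> zorder (\<lambda>s. P s a) (- 2 * of_nat k) = 1)"
  have "1 / 4 \<le> a"
  proof (rule ccontr)
    \<comment> \<open>For \<open>a < 1 / 4\<close> there is a nonnegative real zero, which cannot be
      a negative even integer.\<close>
    assume "\<not> 1 / 4 \<le> a"
    then obtain x where "x \<ge> 0" "P (complex_of_real x) a = 0"
      using P_nonneg_real_zero[of a] assms by auto
    moreover from this(2) * obtain k :: nat where "x = - 2 * real k" "k \<ge> 1" by blast
    ultimately show False by simp
  qed
  with assms show "1/4 \<le> a \<and> a \<le> 1/2" by simp
next
  assume a4: "1/4 \<le> a \<and> a \<le> 1/2"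
  have a1: "a < 1" using assms by simp
  have "P (complex_of_real x) a = 0 \<longleftrightarrow> (\<exists>k::nat. k \<ge> 1 \<and> x = - 2 * real k)" for x
  proof -
    consider "x < 0" | "x = 0" | "x > 0" by linarith
    then show ?thesis
    proof cases
      case 1
      then show ?thesis by (rule P_neg_real_zero_iff[OF assms(1) a1])
    next
      case 2
      then show ?thesis using P_0[OF assms(1) a1] by auto
    next
      case 3
      then show ?thesis using P_pos_real_nonzero[OF assms(1) a1, of x] a4 by auto
    qed
  qed
  then have "{x::real. P (of_real x) a = 0} = {- 2 * real k |k. k \<ge> 1}" by blast
  with zorder_P_neg_even[OF assms(1) a1]
  show "{x::real. P (of_real x) a = 0} = {- 2 * real k |k. k \<ge> 1} \<and>
          (\<forall>k::nat. k \<ge> 1 \<longrightarrow> zorder (\<lambda>s. P s a) (- 2 * of_nat k) = 1)" by blast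
qed

end
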